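(* If the Small Set Expansion Hypothesis holds, then for every $\varepsilon>0$ it is NP-hard to compute a $(2-\varepsilon)$-approximation of the fair densest subgraph problem on fair (edge-weighted) graphs.
   Context: Graphs $G=(V,E,w)$ are undirected with nonnegative edge weights and red/blue vertex coloring; $S$ is fair if it has equally many red and blue vertices, and $G$ is fair if $V$ is. For $S\subseteq V$, $E_S$ is the set of edges inside $S$ and $D_S=w(E_S)/|S|$; the fair densest subgraph problem asks for a fair $S$ maximizing $D_S$, and a $(2-\varepsilon)$-approximation returns a fair set of density at least $OPT/(2-\varepsilon)$. For a $d$-regular weighted graph and $S\subseteq V$, the expansion is $\Phi(S)=w(E(S,V\setminus S))/(d|S|)$. For constants $\eta,\delta\in(0,1)$, the problem $SSE(\eta,\delta)$ is: given a $d$-regular weighted graph, distinguish between (completeness) there is $S\subseteq V$ with $|S|=\delta|V|$ and $\Phi(S)\le\eta$, and (soundness) every $S\subseteq V$ with $|S|=\delta|V|$ has $\Phi(S)\ge1-\eta$. The Small Set Expansion Hypothesis: for every $\eta>0$ there exists $\delta=\delta(\eta)>0$ such that $SSE(\eta,\delta)$ is NP-hard. *)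

theory Defs
  imports Complex_Main "HOL-Library.Log_Nat" "HOL-Computational_Algebra.Polynomial"
begin

section \<open>Random access machines with logarithmic cost\<close>

text \<open>
  Polynomial time is taken over structured random access machine programs under the logarithmic
  cost criterion. Memory consists of arrays of unbounded naturals, initially zero outside the
  input; every value an expression produces, addresses included, is charged its bit length.
\<close>

type_synonym mem = "nat \<Rightarrow> nat \<Rightarrow> nat"

datatype aexp =
    Num nat
  | Arr nat aexp
  | Add aexp aexp
  | Sub aexp aexp
  | Mul aexp aexp
  | Div aexp aexp

fun eval :: "aexp \<Rightarrow> mem \<Rightarrow> nat" where
  "eval (Num k) s = k"
| "eval (Arr a e) s = s a (eval e s)"
| "eval (Add e f) s = eval e s + eval f s"
| "eval (Sub e f) s = eval e s - eval f s"
| "eval (Mul e f) s = eval e s * eval f s"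
| "eval (Div e f) s = eval e s div eval f s"

abbreviation bits :: "nat \<Rightarrow> nat" where
  "bits k \<equiv> floorlog 2 k"

fun cost :: "aexp \<Rightarrow> mem \<Rightarrow> nat" where
  "cost (Num k) s = 1 + bits k"
| "cost (Arr a e) s = 1 + bits (eval (Arr a e) s) + cost e s"
| "cost (Add e f) s = 1 + bits (eval (Add e f) s) + cost e s + cost f s"
| "cost (Sub e f) s = 1 + bits (eval (Sub e f) s) + cost e s + cost f s"
| "cost (Mul e f) s = 1 + bits (eval (Mul e f) s) + cost e s + cost f s"
| "cost (Div e f) s = 1 + bits (eval (Div e f) s) + cost e s + cost f s"

datatype com =
    Skip
  | Store nat aexp aexp
  | Seq com com
  | Cond aexp com com
  | Loop aexp com

text \<open>
  \<open>exec c s t s'\<close>: started in \<open>s\<close>, the program \<open>c\<close> halts in \<open>s'\<close> at cost \<open>t\<close>.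
  Tests succeed on nonzero values.
\<close>

inductive exec :: "com \<Rightarrow> mem \<Rightarrow> nat \<Rightarrow> mem \<Rightarrow> bool" where
  exec_Skip: "exec Skip s 1 s"
| exec_Store: "exec (Store a i e) s (1 + cost i s + cost e s)
     (s(a := (s a)(eval i s := eval e s)))"
| exec_Seq: "exec c s t s' \<Longrightarrow> exec c' s' t' s'' \<Longrightarrow> exec (Seq c c') s (t + t') s''"
| exec_Cond_True: "eval b s \<noteq> 0 \<Longrightarrow> exec c s t s' \<Longrightarrow> exec (Cond b c c') s (1 + cost b s + t) s'"
| exec_Cond_False: "eval b s = 0 \<Longrightarrow> exec c' s t s' \<Longrightarrow> exec (Cond b c c') s (1 + cost b s + t) s'"
| exec_Loop_False: "eval b s = 0 \<Longrightarrow> exec (Loop b c) s (1 + cost b s) s"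
| exec_Loop_True: "eval b s \<noteq> 0 \<Longrightarrow> exec c s t s' \<Longrightarrow> exec (Loop b c) s' t' s'' \<Longrightarrow>
     exec (Loop b c) s (1 + cost b s + t + t') s''"

section \<open>Polynomial time, NP and NP-hardness\<close>

text \<open>
  Words are lists of naturals, thought of as written in binary with a delimiter after each entry.
\<close>

type_synonym word = "nat list"

definition wsize :: "word \<Rightarrow> nat" where
  "wsize x = (\<Sum>k\<leftarrow>x. bits k + 1)"

text \<open>The \<open>a\<close>-th input word sits in array \<open>a\<close>, preceded by its length; the output sits in array 0.\<close>

definition load :: "word list \<Rightarrow> mem" where
  "load ws a i =
     (if a < length ws then
        (if i = 0 then length (ws ! a)
         else if i \<le> length (ws ! a) then ws ! a ! (i - 1) else 0)
      else 0)"

definition out_word :: "mem \<Rightarrow> word" where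
  "out_word s = map (\<lambda>i. s 0 (Suc i)) [0..<s 0 0]"

text \<open>
  The output is charged as well: otherwise a single assignment to the length cell would produce
  an exponentially long output of zeros.
\<close>

definition runs_within :: "com \<Rightarrow> word list \<Rightarrow> word \<Rightarrow> nat \<Rightarrow> bool" where
  "runs_within c ws y b \<longleftrightarrow>
     (\<exists>t s. exec c (load ws) t s \<and> out_word s = y \<and> t + wsize y \<le> b)"

definition polytime_fun :: "(word \<Rightarrow> word) \<Rightarrow> bool" where
  "polytime_fun f \<longleftrightarrow>
     (\<exists>c (p :: nat poly). \<forall>x. runs_within c [x] (f x) (poly p (wsize x)))"

definition polytime_rel :: "(word \<Rightarrow> word \<Rightarrow> bool) \<Rightarrow> bool" where
  "polytime_rel R \<longleftrightarrow>
     (\<exists>c (p :: nat poly). \<forall>x y.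
        runs_within c [x, y] (if R x y then [1] else [0]) (poly p (wsize x + wsize y)))"

definition NP :: "word set set" where
  "NP = {L. \<exists>R (q :: nat poly). polytime_rel R \<and>
          (\<forall>x. x \<in> L \<longleftrightarrow> (\<exists>y. wsize y \<le> poly q (wsize x) \<and> R x y))}"

text \<open>Distinguishing \<open>Yes\<close> from \<open>No\<close>: hardness under polynomial-time many-one reductions.\<close>

definition np_hard_promise :: "word set \<Rightarrow> word set \<Rightarrow> bool" where
  "np_hard_promise Yes No \<longleftrightarrow>
     (\<forall>L\<in>NP. \<exists>f. polytime_fun f \<and>
        (\<forall>x. (x \<in> L \<longrightarrow> f x \<in> Yes) \<and> (x \<notin> L \<longrightarrow> f x \<in> No)))"

text \<open>
  Computing, for each instance in \<open>I\<close>, some answer related to it by \<open>A\<close>: membership of \<open>x\<close>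
  in the NP language is decided in polynomial time from \<open>x\<close> and an arbitrary correct answer \<open>y\<close>
  to the single instance \<open>f x\<close>.
\<close>

definition np_hard_search :: "word set \<Rightarrow> (word \<Rightarrow> word \<Rightarrow> bool) \<Rightarrow> bool" where
  "np_hard_search I A \<longleftrightarrow>
     (\<forall>L\<in>NP. \<exists>f g. polytime_fun f \<and> polytime_rel g \<and>
        (\<forall>x. f x \<in> I \<and> (\<forall>y. A (f x) y \<longrightarrow> (g x y \<longleftrightarrow> x \<in> L))))"

section \<open>Weighted graphs\<close>

record 'v wgraph =
  verts :: "'v set"
  edges :: "'v set set"
  wt :: "'v set \<Rightarrow> real"

definition wgraph :: "('v, 'z) wgraph_scheme \<Rightarrow> bool" where
  "wgraph G \<longleftrightarrow> finite (verts G) \<and>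
     (\<forall>e\<in>edges G. e \<subseteq> verts G \<and> card e = 2 \<and> 0 \<le> wt G e)"

text \<open>
  Row-major adjacency matrix on the vertices \<open>0, \<dots>, n - 1\<close>, preceded by \<open>n\<close>; each entry is a
  rational weight given by a numerator and a denominator, not necessarily in lowest terms.
\<close>

definition encodes_graph :: "word \<Rightarrow> (nat, 'z) wgraph_scheme \<Rightarrow> bool" where
  "encodes_graph x G \<longleftrightarrow>
     (\<exists>n. verts G = {..<n} \<and> length x = 1 + 2 * n ^ 2 \<and> x ! 0 = n \<and>
        (\<forall>u<n. \<forall>v<n. let i = 1 + 2 * (n * u + v) in
           x ! (i + 1) \<noteq> 0 \<and>
           real (x ! i) / real (x ! (i + 1)) =
             (if {u, v} \<in> edges G then wt G {u, v} else 0)))"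

section \<open>Small set expansion\<close>

definition regular :: "('v, 'z) wgraph_scheme \<Rightarrow> real \<Rightarrow> bool" where
  "regular G d \<longleftrightarrow> (\<forall>v\<in>verts G. (\<Sum>e | e \<in> edges G \<and> v \<in> e. wt G e) = d)"

definition edges_between :: "('v, 'z) wgraph_scheme \<Rightarrow> 'v set \<Rightarrow> 'v set \<Rightarrow> 'v set set" where
  "edges_between G S T = {e \<in> edges G. \<exists>u\<in>S. \<exists>v\<in>T. e = {u, v}}"

definition expansion :: "('v, 'z) wgraph_scheme \<Rightarrow> real \<Rightarrow> 'v set \<Rightarrow> real" where
  "expansion G d S =
     (\<Sum>e\<in>edges_between G S (verts G - S). wt G e) / (d * real (card S))"

text \<open>Nonempty vertex set and positive degree make the expansion of the sets considered defined.\<close>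

definition sse_instance :: "word \<Rightarrow> nat wgraph \<Rightarrow> real \<Rightarrow> bool" where
  "sse_instance x G d \<longleftrightarrow>
     encodes_graph x G \<and> wgraph G \<and> verts G \<noteq> {} \<and> regular G d \<and> 0 < d"

definition sse_yes :: "real \<Rightarrow> real \<Rightarrow> word set" where
  "sse_yes \<eta> \<delta> = {x. \<exists>G d. sse_instance x G d \<and>
     (\<exists>S\<subseteq>verts G. real (card S) = \<delta> * real (card (verts G)) \<and> expansion G d S \<le> \<eta>)}"

definition sse_no :: "real \<Rightarrow> real \<Rightarrow> word set" where
  "sse_no \<eta> \<delta> = {x. \<exists>G d. sse_instance x G d \<and>
     (\<forall>S\<subseteq>verts G. real (card S) = \<delta> * real (card (verts G)) \<longrightarrow> expansion G d S \<ge> 1 - \<eta>)}"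

definition small_set_expansion_hypothesis :: bool where
  "small_set_expansion_hypothesis \<longleftrightarrow>
     (\<forall>\<eta>. 0 < \<eta> \<and> \<eta> < 1 \<longrightarrow>
        (\<exists>\<delta>. 0 < \<delta> \<and> \<delta> < 1 \<and> np_hard_promise (sse_yes \<eta> \<delta>) (sse_no \<eta> \<delta>)))"

section \<open>Fair densest subgraphs\<close>

datatype colour = Red | Blue

record 'v cgraph = "'v wgraph" +
  col :: "'v \<Rightarrow> colour"

definition fair :: "'v cgraph \<Rightarrow> 'v set \<Rightarrow> bool" where
  "fair G S \<longleftrightarrow> card {v \<in> S. col G v = Red} = card {v \<in> S. col G v = Blue}"

definition density :: "('v, 'z) wgraph_scheme \<Rightarrow> 'v set \<Rightarrow> real" where
  "density G S = (\<Sum>e | e \<in> edges G \<and> e \<subseteq> S. wt G e) / real (card S)"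

text \<open>The density is undefined on the empty set, so only nonempty fair sets are feasible.\<close>

definition feasible :: "'v cgraph \<Rightarrow> 'v set set" where
  "feasible G = {S. S \<subseteq> verts G \<and> S \<noteq> {} \<and> fair G S}"

definition opt_density :: "'v cgraph \<Rightarrow> real" where
  "opt_density G = Max (density G ` feasible G)"

definition fair_approximation :: "real \<Rightarrow> 'v cgraph \<Rightarrow> 'v set \<Rightarrow> bool" where
  "fair_approximation \<alpha> G S \<longleftrightarrow> S \<in> feasible G \<and> density G S \<ge> opt_density G / \<alpha>"

definition encodes_cgraph :: "word \<Rightarrow> nat cgraph \<Rightarrow> bool" where
  "encodes_cgraph x G \<longleftrightarrow>
     (\<exists>y. encodes_graph y G \<and>
        x = y @ map (\<lambda>v. if col G v = Red then 1 else 0) [0..<card (verts G)])"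

definition fds_instance :: "word \<Rightarrow> nat cgraph \<Rightarrow> bool" where
  "fds_instance x G \<longleftrightarrow>
     encodes_cgraph x G \<and> wgraph G \<and> verts G \<noteq> {} \<and> fair G (verts G)"

definition fds_instances :: "word set" where
  "fds_instances = {x. \<exists>G. fds_instance x G}"

text \<open>Answers are characteristic vectors of vertex sets.\<close>

definition fds_answer :: "real \<Rightarrow> word \<Rightarrow> word \<Rightarrow> bool" where
  "fds_answer \<alpha> x y \<longleftrightarrow>
     (\<exists>G S. fds_instance x G \<and> fair_approximation \<alpha> G S \<and>
        y = map (\<lambda>v. if v \<in> S then 1 else 0) [0..<card (verts G)])"

end

theory Submission
  imports Defs
begin

text \<open>
  Write \<open>x(R)\<close> for the sum of the weights over ordered pairs in \<open>R\<close>. Given a \<open>d\<close>-regular graph on \<open>n\<close>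
  vertices and \<open>t = \<delta> n\<close>, colour its vertices red and add \<open>n\<close> blue vertices, \<open>t\<close> of which form a
  clique with edge weight \<open>d / (t - 1)\<close>. If some \<open>S\<close> of size \<open>t\<close> has expansion at most \<open>\<eta>\<close>, then \<open>S\<close>
  together with the clique has density at least \<open>(2 - \<eta>) d / 4\<close>. A fair set with red part \<open>R\<close> of
  size \<open>k\<close> has density at most \<open>(x(R) + d min(k, t)\<^sup>2 / t) / (4 k)\<close>. If all sets of size \<open>t\<close> have
  expansion at least \<open>1 - \<eta>\<close>, then \<open>x(R) \<le> \<eta> d t\<close> for \<open>k \<le> t\<close> by monotonicity and
  \<open>x(R) \<le> 2 \<eta> d k\<^sup>2 / t\<close> for \<open>k \<ge> t \<ge> 2\<close> by averaging; with \<open>x(R) \<le> d k\<close> this keeps the bound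
  below \<open>(1 + 2 \<eta>) d / 4\<close>. So the red part of a \<open>(2 - \<epsilon>)\<close>-approximate answer decides
  the instance once \<open>5 \<eta> < \<epsilon>\<close>. Hardness forces \<open>\<delta>\<close> to be rational, so \<open>t\<close> is computable, and
  \<open>t = 1\<close> never admits a set of small expansion.
\<close>

section \<open>Weights as sums over ordered pairs\<close>

text \<open>The clique weight \<open>d / (t - 1)\<close> gives every clique vertex degree
  \<open>d\<close>, so the clique is at least as dense as a red set that does not expand. Fairness
  makes the two compete: about \<open>t\<close> red vertices have hardly any inner weight under
  soundness, while many red vertices dilute the clique, and either way half of the density is lost.
  With \<open>r = k / t\<close> and densities in units of \<open>d / 4\<close>, the soundness bound
  is \<open>min 1 (\<eta> / r) + r\<close> for \<open>r \<le> 1\<close> and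
  \<open>min 1 (2 * \<eta> * r) + 1 / r\<close> for \<open>r \<ge> 1\<close>. Where the second
  argument of \<open>min\<close> is the smaller one, the bound is convex in \<open>r\<close>, so its
  maximum sits at the ends of that range, one of them \<open>r = 1\<close>, the other where
  \<open>min\<close> switches. The machine side has two obstacles. Weights are fractions with
  unrelated denominators, whose exact sums must keep polynomial bit length. And the decision
  procedure is given \<open>x\<close> and an answer but not the graph word, so it has to rerun an
  unknown program whose behaviour is specified only on a freshly loaded input.\<close>

definition adj :: "('v, 'z) wgraph_scheme \<Rightarrow> 'v \<Rightarrow> 'v \<Rightarrow> real" where
  "adj G u v = (if {u, v} \<in> edges G then wt G {u, v} else 0)"

definition qsum :: "('v \<Rightarrow> 'v \<Rightarrow> real) \<Rightarrow> 'v set \<Rightarrow> real" where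
  "qsum a S = (\<Sum>u\<in>S. \<Sum>v\<in>S. a u v)"

lemma finite_edges: "wgraph G \<Longrightarrow> finite (edges G)"
  by (rule finite_subset[of _ "Pow (verts G)"]) (auto simp: wgraph_def)

text \<open>Group the ordered pairs by the edge they span: an edge has two distinct endpoints, so
  every fibre consists of exactly two pairs.\<close>

lemma inner_weight_eq_qsum:
  assumes G: "wgraph G" and S: "finite S"
  shows "2 * (\<Sum>e | e \<in> edges G \<and> e \<subseteq> S. wt G e) = qsum (adj G) S"
proof -
  define P where "P = {p \<in> S \<times> S. {fst p, snd p} \<in> edges G}"
  define E where "E = {e. e \<in> edges G \<and> e \<subseteq> S}"
  have finP: "finite P" using S by (simp add: P_def)
  have finE: "finite E" using finite_edges[OF G] by (simp add: E_def)
  have "qsum (adj G) S = (\<Sum>p\<in>S \<times> S. adj G (fst p) (snd p))"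
    by (simp add: qsum_def sum.cartesian_product case_prod_beta)
  also have "\<dots> = (\<Sum>p\<in>P. wt G {fst p, snd p})"
    unfolding P_def by (subst sum.inter_filter) (use S in \<open>auto simp: adj_def intro!: sum.cong\<close>)
  also have "\<dots> = (\<Sum>e\<in>E. \<Sum>p | p \<in> P \<and> {fst p, snd p} = e. wt G {fst p, snd p})"
    by (rule sum.group[symmetric, OF finP finE]) (auto simp: P_def E_def)
  also have "\<dots> = (\<Sum>e\<in>E. 2 * wt G e)"
  proof (rule sum.cong[OF refl])
    fix e assume e: "e \<in> E"
    then have "card e = 2" using G by (auto simp: E_def wgraph_def)
    then obtain u v where uv: "e = {u, v}" "u \<noteq> v" by (auto simp: card_2_iff)
    have *: "{p. p \<in> P \<and> {fst p, snd p} = e} = {(u, v), (v, u)}"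
      using e uv by (auto simp: P_def E_def doubleton_eq_iff insert_commute)
    show "(\<Sum>p | p \<in> P \<and> {fst p, snd p} = e. wt G {fst p, snd p}) = 2 * wt G e"
      unfolding * using uv by (simp add: insert_commute)
  qed
  finally show ?thesis by (simp add: E_def sum_distrib_left)
qed

text \<open>Unlike for inner edges there is no factor 2: only one endpoint of a cut edge lies in
  \<open>S\<close>, so the edge determines its ordered pair.\<close>

lemma cut_weight_eq_sum:
  assumes G: "wgraph G" and S: "S \<subseteq> verts G"
  shows "(\<Sum>e\<in>edges_between G S (verts G - S). wt G e) = (\<Sum>u\<in>S. \<Sum>v\<in>verts G - S. adj G u v)"
proof -
  define P where "P = {p \<in> S \<times> (verts G - S). {fst p, snd p} \<in> edges G}"
  have fin: "finite (S \<times> (verts G - S))" using G S by (auto simp: wgraph_def intro: finite_subset)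
  have inj: "inj_on (\<lambda>p. {fst p, snd p}) P"
    by (auto simp: inj_on_def P_def doubleton_eq_iff)
  have im: "(\<lambda>p. {fst p, snd p}) ` P = edges_between G S (verts G - S)"
  proof (intro equalityI subsetI)
    fix e assume "e \<in> edges_between G S (verts G - S)"
    then obtain u v where "u \<in> S" "v \<in> verts G - S" "e = {u, v}" "e \<in> edges G"
      by (auto simp: edges_between_def)
    then show "e \<in> (\<lambda>p. {fst p, snd p}) ` P"
      by (intro image_eqI[of _ _ "(u, v)"]) (simp_all add: P_def)
  qed (auto simp: P_def edges_between_def, blast)
  have "(\<Sum>u\<in>S. \<Sum>v\<in>verts G - S. adj G u v) = (\<Sum>p\<in>S \<times> (verts G - S). adj G (fst p) (snd p))"
    by (simp add: sum.cartesian_product case_prod_beta)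
  also have "\<dots> = (\<Sum>p\<in>P. wt G {fst p, snd p})"
    unfolding P_def by (subst sum.inter_filter) (use fin in \<open>auto simp: adj_def intro!: sum.cong\<close>)
  also have "\<dots> = (\<Sum>e\<in>edges_between G S (verts G - S). wt G e)"
    unfolding im[symmetric] by (simp add: sum.reindex[OF inj])
  finally show ?thesis by simp
qed

lemma degree_eq_sum:
  assumes G: "wgraph G" and v: "v \<in> verts G"
  shows "(\<Sum>e | e \<in> edges G \<and> v \<in> e. wt G e) = (\<Sum>u\<in>verts G. adj G v u)"
proof -
  define P where "P = {u \<in> verts G. {v, u} \<in> edges G}"
  have inj: "inj_on (\<lambda>u. {v, u}) P" by (auto simp: inj_on_def doubleton_eq_iff)
  have im: "(\<lambda>u. {v, u}) ` P = {e. e \<in> edges G \<and> v \<in> e}"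
  proof (intro equalityI subsetI)
    fix e assume "e \<in> {e. e \<in> edges G \<and> v \<in> e}"
    then have e: "e \<in> edges G" "v \<in> e" "card e = 2" "e \<subseteq> verts G" using G by (auto simp: wgraph_def)
    then obtain u where "e = {v, u}" by (auto simp: card_2_iff)
    then show "e \<in> (\<lambda>u. {v, u}) ` P" using e by (auto simp: P_def)
  qed (auto simp: P_def)
  have "(\<Sum>u\<in>verts G. adj G v u) = (\<Sum>u\<in>P. wt G {v, u})"
    unfolding P_def by (subst sum.inter_filter) (use G in \<open>auto simp: adj_def wgraph_def intro!: sum.cong\<close>)
  then show ?thesis unfolding im[symmetric] by (simp add: sum.reindex[OF inj])
qed

lemma adj_commute: "adj G u v = adj G v u"
  by (simp add: adj_def insert_commute)

lemma adj_nonneg: "wgraph G \<Longrightarrow> 0 \<le> adj G u v"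
  by (auto simp: adj_def wgraph_def)

lemma adj_diag: "wgraph G \<Longrightarrow> adj G u u = 0"
  by (auto simp: adj_def wgraph_def)

section \<open>Monotonicity and averaging in regular weight matrices\<close>

locale regular_matrix =
  fixes V :: "'v set" and a :: "'v \<Rightarrow> 'v \<Rightarrow> real" and d :: real
  assumes finite_V: "finite V"
    and nonneg: "u \<in> V \<Longrightarrow> v \<in> V \<Longrightarrow> 0 \<le> a u v"
    and sym: "u \<in> V \<Longrightarrow> v \<in> V \<Longrightarrow> a u v = a v u"
    and diag: "v \<in> V \<Longrightarrow> a v v = 0"
    and row_sum: "v \<in> V \<Longrightarrow> (\<Sum>u\<in>V. a v u) = d"
    and d_pos: "0 < d"
begin

lemma finite_sub: "S \<subseteq> V \<Longrightarrow> finite S"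
  using finite_V by (rule rev_finite_subset)

lemma qsum_mono:
  assumes "R \<subseteq> S" "S \<subseteq> V"
  shows "qsum a R \<le> qsum a S"
proof -
  have "qsum a R \<le> (\<Sum>u\<in>R. \<Sum>v\<in>S. a u v)" unfolding qsum_def
    by (intro sum_mono sum_mono2) (use assms finite_sub nonneg in \<open>auto simp: subset_iff\<close>)
  also have "\<dots> \<le> qsum a S" unfolding qsum_def
    by (intro sum_mono2 sum_nonneg) (use assms finite_sub nonneg in \<open>auto simp: subset_iff\<close>)
  finally show ?thesis .
qed

text \<open>The rows indexed by \<open>S\<close>, each of sum \<open>d\<close>, are split at
  \<open>S\<close>. This converts bounds on the cut, and so on the expansion, into bounds on the
  inner weight.\<close>

lemma qsum_add_cut:
  assumes "S \<subseteq> V"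
  shows "qsum a S + (\<Sum>u\<in>S. \<Sum>v\<in>V - S. a u v) = d * card S"
proof -
  have "qsum a S + (\<Sum>u\<in>S. \<Sum>v\<in>V - S. a u v) = (\<Sum>u\<in>S. \<Sum>v\<in>V. a u v)"
    unfolding qsum_def sum.distrib[symmetric]
    by (rule sum.cong) (simp_all add: sum.subset_diff[OF assms finite_V] add.commute)
  also have "\<dots> = (\<Sum>u\<in>S. d)" by (rule sum.cong) (use assms row_sum in auto)
  finally show ?thesis by simp
qed

lemma qsum_le:
  assumes "S \<subseteq> V" shows "qsum a S \<le> d * card S"
proof -
  have "0 \<le> (\<Sum>u\<in>S. \<Sum>v\<in>V - S. a u v)"
    by (intro sum_nonneg) (use assms nonneg in auto)
  then show ?thesis using qsum_add_cut[OF assms] by linarith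
qed

text \<open>The row and the column of \<open>v\<close> disappear. They have equal sums by symmetry,
  and the zero diagonal means that nothing is subtracted twice.\<close>

lemma qsum_remove:
  assumes "R \<subseteq> V" "v \<in> R"
  shows "qsum a (R - {v}) = qsum a R - 2 * (\<Sum>u\<in>R. a v u)"
proof -
  have fin: "finite R" using assms finite_sub by auto
  have "qsum a R = (\<Sum>u\<in>R. a v u) + (\<Sum>u\<in>R - {v}. a u v + (\<Sum>w\<in>R - {v}. a u w))"
    unfolding qsum_def by (simp add: sum.remove[OF fin assms(2)])
  also have "\<dots> = (\<Sum>u\<in>R. a v u) + (\<Sum>u\<in>R - {v}. a u v) + qsum a (R - {v})"
    by (simp add: sum.distrib qsum_def)
  also have "(\<Sum>u\<in>R - {v}. a u v) = (\<Sum>u\<in>R. a v u)"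
  proof -
    have "(\<Sum>u\<in>R. a v u) = (\<Sum>u\<in>R. a u v)"
      by (rule sum.cong) (use assms sym in blast)+
    also have "\<dots> = (\<Sum>u\<in>R - {v}. a u v)"
      using assms diag[of v] by (subst sum.remove[OF fin assms(2)]) auto
    finally show ?thesis ..
  qed
  finally show ?thesis by simp
qed

text \<open>An ordered pair of distinct vertices of \<open>R\<close> survives \<open>k - 2\<close>
  of the \<open>k\<close> removals of a single vertex, so averaging over the removals shows that a
  bound on \<open>qsum a R / (k * (k - 1))\<close> passes from size \<open>k - 1\<close> to size
  \<open>k\<close>. The statement is this with denominators cleared.\<close>

lemma qsum_average:
  assumes t: "2 \<le> t" and M: "\<And>S. S \<subseteq> V \<Longrightarrow> card S = t \<Longrightarrow> qsum a S \<le> M"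
  shows "R \<subseteq> V \<Longrightarrow> card R = t + j \<Longrightarrow>
    qsum a R * (real t * (real t - 1)) \<le> M * (real (t + j) * (real (t + j) - 1))"
proof (induction j arbitrary: R)
  case 0
  then show ?case using M[of R] t by (auto intro!: mult_right_mono)
next
  case (Suc j)
  define k where "k = card R"
  define X where "X = real t * (real t - 1)"
  have fin: "finite R" using Suc finite_sub by auto
  \<comment> \<open>Thanks to \<open>2 \<le> t\<close>, the factor \<open>k - 2\<close> that is
    cancelled below is positive.\<close>
  have k: "k = Suc (t + j)" "k \<ge> 3" using Suc t by (auto simp: k_def)
  define Y where "Y = M * ((real k - 1) * (real k - 2))"
  have "qsum a (R - {v}) * X \<le> Y" if "v \<in> R" for v
    using Suc.IH[of "R - {v}"] Suc.prems that fin k by (auto simp: X_def Y_def)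
  then have "(\<Sum>v\<in>R. qsum a (R - {v}) * X) \<le> (\<Sum>v\<in>R. Y)" by (rule sum_mono)
  moreover have "(\<Sum>v\<in>R. qsum a (R - {v}) * X) = (real k - 2) * qsum a R * X"
  proof -
    have "(\<Sum>v\<in>R. qsum a (R - {v})) = (\<Sum>v\<in>R. qsum a R - 2 * (\<Sum>u\<in>R. a v u))"
      by (rule sum.cong) (use Suc.prems qsum_remove in auto)
    also have "\<dots> = real k * qsum a R - 2 * qsum a R"
      by (simp add: sum_subtractf k_def qsum_def sum_distrib_left)
    finally have e: "(\<Sum>v\<in>R. qsum a (R - {v})) = (real k - 2) * qsum a R" by (simp add: algebra_simps)
    show ?thesis unfolding sum_distrib_right[symmetric] e ..
  qed
  ultimately have "(real k - 2) * (qsum a R * X) \<le> (real k - 2) * (M * (real k * (real k - 1)))"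
    by (simp add: Y_def k_def algebra_simps)
  then have "qsum a R * X \<le> M * (real k * (real k - 1))"
    using k by (subst (asm) mult_le_cancel_left_pos) auto
  then show ?case by (simp add: X_def k)
qed

text \<open>
  Both regimes reduce to the nonpositivity of \<open>(k - t) * (k - \<eta> * t)\<close>
  or \<open>(k - t) * (2 * \<eta> * k - t)\<close> between the roots.
\<close>

lemma qsum_soundness:
  assumes t: "2 \<le> t" and tV: "t \<le> card V" and \<eta>: "0 < \<eta>"
    and S: "\<And>S. S \<subseteq> V \<Longrightarrow> card S = t \<Longrightarrow> qsum a S \<le> \<eta> * d * t"
    and R: "R \<subseteq> V"
  shows "qsum a R + d * (real (min (card R) t))\<^sup>2 / t \<le> (1 + 2 * \<eta>) * d * card R"
proof -
  define k where "k = real (card R)"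
  define x where "x = qsum a R / d"
  define T where "T = real t"
  have T: "T \<ge> 2" using t by (simp add: T_def)
  have k0: "k \<ge> 0" by (simp add: k_def)
  have xk: "x \<le> k" using qsum_le[OF R] d_pos by (simp add: x_def k_def field_simps)
  have "x + (min k T)\<^sup>2 / T \<le> (1 + 2 * \<eta>) * k"
  proof (cases "k \<le> T")
    case True
    have "card R \<le> t" using True by (simp add: k_def T_def)
    then obtain S' where S': "R \<subseteq> S'" "S' \<subseteq> V" "card S' = t"
      using exists_subset_between[of R t V] tV R finite_V by auto
    have "qsum a R \<le> \<eta> * d * t" using qsum_mono[OF S'(1,2)] S[OF S'(2,3)] by linarith
    then have x\<eta>: "x \<le> \<eta> * T" using d_pos by (simp add: x_def T_def field_simps)
    \<comment> \<open>Up to \<open>k = \<eta> * T\<close> the trivial bound \<open>x \<le> k\<close>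
      is the better one, beyond it \<open>x \<le> \<eta> * T\<close>.\<close>
    have "x * T + k\<^sup>2 \<le> (1 + 2 * \<eta>) * k * T"
    proof (cases "k \<le> \<eta> * T")
      case c: True
      have "x * T \<le> k * T" "k * k \<le> \<eta> * T * k" "0 \<le> \<eta> * T * k"
        using xk c T k0 \<eta> by (auto intro: mult_right_mono)
      then show ?thesis by (simp add: algebra_simps power2_eq_square)
    next
      case c: False
      have "x * T \<le> \<eta> * T * T" "(k - T) * (k - \<eta> * T) \<le> 0" "0 \<le> \<eta> * T * k"
        using x\<eta> c True T k0 \<eta> by (auto intro: mult_right_mono simp: mult_le_0_iff)
      then show ?thesis by (simp add: algebra_simps power2_eq_square)
    qed
    then show ?thesis using True T by (simp add: field_simps)
  next
    case False
    then have kt: "card R > t" by (simp add: k_def T_def)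
    have "qsum a R * (T * (T - 1)) \<le> \<eta> * d * t * (k * (k - 1))"
      using qsum_average[OF t S R, of "card R - t"] kt by (simp add: k_def T_def)
    then have "x * (T * (T - 1)) \<le> \<eta> * T * (k * (k - 1))"
      using d_pos by (simp add: x_def T_def field_simps)
    then have "T * (x * (T - 1)) \<le> T * (\<eta> * k * (k - 1))" by (simp add: algebra_simps)
    then have 1: "x * (T - 1) \<le> \<eta> * k * (k - 1)" using T by simp
    \<comment> \<open>Origin of the factor 2 in the averaged bound: \<open>(k - 1) / (T - 1)\<close>
      is at most \<open>2 * k / T\<close> when \<open>T \<ge> 2\<close>.\<close>
    have "0 \<le> k * (T - 2)" using T k0 by simp
    then have 2: "T * (k - 1) \<le> 2 * k * (T - 1)" using T by (simp add: algebra_simps)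
    have "x * T * (T - 1) \<le> \<eta> * k * (T * (k - 1))" using mult_right_mono[OF 1, of T] T by (simp add: algebra_simps)
    also have "\<dots> \<le> \<eta> * k * (2 * k * (T - 1))" using 2 \<eta> k0 by (intro mult_left_mono) auto
    finally have "(T - 1) * (x * T) \<le> (T - 1) * (2 * \<eta> * k\<^sup>2)" by (simp add: algebra_simps power2_eq_square)
    then have x\<eta>: "x * T \<le> 2 * \<eta> * k\<^sup>2" using T by simp
    \<comment> \<open>Once \<open>2 * \<eta> * k\<close> pays for the whole clique term
      \<open>T\<close>, the trivial bound \<open>x \<le> k\<close> suffices; before that the
      averaged bound takes over.\<close>
    have "x + T \<le> (1 + 2 * \<eta>) * k"
    proof (cases "T \<le> 2 * \<eta> * k")
      case True
      then show ?thesis using xk by (simp add: algebra_simps)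
    next
      case c: False
      have "(k - T) * (2 * \<eta> * k - T) \<le> 0" using c False by (auto simp: mult_le_0_iff)
      then have "T * (x + T) \<le> T * ((1 + 2 * \<eta>) * k)"
        using x\<eta> by (simp add: algebra_simps power2_eq_square)
      then show ?thesis using T by simp
    qed
    then show ?thesis using False T by (simp add: power2_eq_square)
  qed
  then have "d * (x + (min k T)\<^sup>2 / T) \<le> d * ((1 + 2 * \<eta>) * k)" using d_pos by simp
  then show ?thesis using d_pos by (simp add: x_def k_def T_def algebra_simps of_nat_min)
qed

end

lemma expansion_eq:
  assumes G: "wgraph G" and reg: "regular_matrix (verts G) (adj G) d"
    and S: "S \<subseteq> verts G" "S \<noteq> {}"
  shows "expansion G d S = 1 - qsum (adj G) S / (d * card S)"
proof -
  interpret regular_matrix "verts G" "adj G" d by (rule reg)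
  have "0 < d * card S" using d_pos S finite_sub by (auto simp: card_gt_0_iff)
  then show ?thesis
    using qsum_add_cut[OF S(1)] unfolding expansion_def cut_weight_eq_sum[OF G S(1)]
    by (simp add: divide_simps) (auto simp: algebra_simps intro!: Nat.gr0I)
qed

text \<open>The other instance of the locale is \<open>wmat z\<close>, the matrix that programs read
  off a word. Its entries mean nothing outside the index range, which is why the locale speaks of
  matrices and restricts its conditions to \<open>V\<close>.\<close>

lemma regular_matrix_adj:
  assumes "wgraph G" "regular G d" "0 < d"
  shows "regular_matrix (verts G) (adj G) d"
proof
  show "finite (verts G)" using assms by (simp add: wgraph_def)
  show "(\<Sum>u\<in>verts G. adj G v u) = d" if "v \<in> verts G" for v
    using degree_eq_sum[OF assms(1) that] assms(2) that by (simp add: regular_def)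
qed (use assms in \<open>simp_all add: adj_nonneg adj_diag adj_commute\<close>)

section \<open>The reduction on words\<close>

definition wmat :: "word \<Rightarrow> nat \<Rightarrow> nat \<Rightarrow> real" where
  "wmat z u v = real (z ! (1 + 2 * (z ! 0 * u + v))) / real (z ! (2 + 2 * (z ! 0 * u + v)))"

text \<open>The part of \<open>encodes_graph\<close> that concerns the word alone. Denominators are
  addressed by a flat index because the loops of the programs run over flat indices.\<close>

definition graph_word :: "word \<Rightarrow> nat \<Rightarrow> bool" where
  "graph_word z n \<longleftrightarrow> length z = 1 + 2 * n ^ 2 \<and> z ! 0 = n \<and> (\<forall>i<n * n. z ! (2 + 2 * i) \<noteq> 0)"

lemma index_less: "u < n \<Longrightarrow> v < n \<Longrightarrow> n * u + v < n * (n::nat)"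
proof -
  assume "u < n" "v < n"
  then have "n * u + v < n * Suc u" by simp
  also have "\<dots> \<le> n * n" using \<open>u < n\<close> by (intro mult_le_mono) auto
  finally show ?thesis .
qed

lemma graph_word_iff:
  "graph_word z n \<longleftrightarrow> length z = 1 + 2 * n ^ 2 \<and> z ! 0 = n \<and>
     (\<forall>u<n. \<forall>v<n. z ! (2 + 2 * (n * u + v)) \<noteq> 0)"
proof -
  have "(\<forall>i<n * n. Q i) \<longleftrightarrow> (\<forall>u<n. \<forall>v<n. Q (n * u + v))" for Q :: "nat \<Rightarrow> bool"
  proof safe
    fix i assume *: "\<forall>u<n. \<forall>v<n. Q (n * u + v)" "i < n * n"
    then have "i div n < n" "i mod n < n" by (auto simp: less_mult_imp_div_less intro!: mod_less_divisor gr0I)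
    then show "Q i" using *(1) by (metis mult_div_mod_eq)
  qed (use index_less in auto)
  then show ?thesis unfolding graph_word_def by auto
qed

lemma encodes_graph_iff:
  "encodes_graph z G \<longleftrightarrow>
     (\<exists>n. verts G = {..<n} \<and> graph_word z n \<and> (\<forall>u<n. \<forall>v<n. wmat z u v = adj G u v))"
proof -
  have "1 + 2 * i + 1 = 2 + 2 * i" for i :: nat by simp
  then show ?thesis unfolding encodes_graph_def graph_word_iff wmat_def adj_def[symmetric] Let_def
    by (intro ex_cong1) (simp only:, blast)
qed

section \<open>Sums of fractions in integer arithmetic\<close>

primrec frac_den :: "(nat \<Rightarrow> nat) \<Rightarrow> (nat \<Rightarrow> bool) \<Rightarrow> nat \<Rightarrow> nat" where
  "frac_den b P 0 = 1"
| "frac_den b P (Suc i) = (if P i then frac_den b P i * b i else frac_den b P i)"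

text \<open>Mirrors the loop of \<open>sum_prog\<close>, which never reduces its running fraction:
  no gcd has to be computed, and the product of the denominators still has bit length linear in the
  size of the word.\<close>

primrec frac_num :: "(nat \<Rightarrow> nat) \<Rightarrow> (nat \<Rightarrow> nat) \<Rightarrow> (nat \<Rightarrow> bool) \<Rightarrow> nat \<Rightarrow> nat" where
  "frac_num a b P 0 = 0"
| "frac_num a b P (Suc i) = (if P i then frac_num a b P i * b i + frac_den b P i * a i else frac_num a b P i)"

lemma frac_den_pos: "(\<And>i. i < k \<Longrightarrow> b i \<noteq> 0) \<Longrightarrow> 0 < frac_den b P k"
  by (induction k) auto

lemma frac_eq_sum:
  "(\<And>i. i < k \<Longrightarrow> b i \<noteq> 0) \<Longrightarrow>
   real (frac_num a b P k) / real (frac_den b P k) = (\<Sum>i<k. if P i then real (a i) / real (b i) else 0)"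
proof (induction k)
  case (Suc k)
  have "0 < frac_den b P k" using Suc.prems by (intro frac_den_pos) auto
  moreover have "b k \<noteq> 0" using Suc.prems by simp
  ultimately have "real (frac_num a b P (Suc k)) / real (frac_den b P (Suc k)) =
    real (frac_num a b P k) / real (frac_den b P k) + (if P k then real (a k) / real (b k) else 0)"
    by (simp add: add_divide_distrib)
  then show ?case using Suc.IH Suc.prems by simp
qed simp

text \<open>Bounds the bit length of the unreduced fraction by the size of the input.\<close>

lemma frac_le_prod:
  "(\<And>i. i < k \<Longrightarrow> b i \<noteq> 0) \<Longrightarrow> frac_num a b P k + frac_den b P k \<le> (\<Prod>i<k. a i + b i)"
proof (induction k)
  case (Suc k)
  then have IH: "frac_num a b P k + frac_den b P k \<le> (\<Prod>i<k. a i + b i)" and b: "1 \<le> b k" by (auto simp: Suc_le_eq)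
  have "frac_num a b P (Suc k) + frac_den b P (Suc k) \<le> (frac_num a b P k + frac_den b P k) * (a k + b k)"
  proof (cases "P k")
    case False
    have "(frac_num a b P k + frac_den b P k) * 1 \<le> (frac_num a b P k + frac_den b P k) * (a k + b k)"
      using b by (intro mult_le_mono) auto
    then show ?thesis using False by simp
  qed (simp add: algebra_simps)
  also have "\<dots> \<le> (\<Prod>i<k. a i + b i) * (a k + b k)" using IH by (rule mult_le_mono1)
  finally show ?case by simp
qed simp

abbreviation wnum :: "word \<Rightarrow> nat \<Rightarrow> nat" where "wnum z i \<equiv> z ! (1 + 2 * i)"
abbreviation wden :: "word \<Rightarrow> nat \<Rightarrow> nat" where "wden z i \<equiv> z ! (2 + 2 * i)"

text \<open>The flat indices below \<open>z ! 0\<close> are the row of vertex 0, and by regularity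
  one row gives the common degree.\<close>

definition deg_num :: "word \<Rightarrow> nat" where
  "deg_num z = frac_num (wnum z) (wden z) (\<lambda>_. True) (z ! 0)"
definition deg_den :: "word \<Rightarrow> nat" where
  "deg_den z = frac_den (wden z) (\<lambda>_. True) (z ! 0)"

context
  fixes p q :: nat
begin

text \<open>\<open>p / q\<close> is the rational value of \<open>\<delta>\<close>. Rounding is
  harmless: the division is exact on yes-instances, and \<open>accepts\<close> rejects whenever it
  is not.\<close>

definition clique_size :: "word \<Rightarrow> nat" where
  "clique_size z = p * z ! 0 div q"

text \<open>The inequality on \<open>u\<close> puts it among the last \<open>clique_size z\<close>
  of the \<open>2 * z ! 0\<close> vertices. It is strict and free of subtraction so that a program
  can test it by whether a truncated difference is nonzero.\<close>

definition out_num :: "word \<Rightarrow> nat \<Rightarrow> nat \<Rightarrow> nat" where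
  "out_num z u v =
     (if u < z ! 0 \<and> v < z ! 0 then wnum z (z ! 0 * u + v)
      else if 2 * z ! 0 < u + clique_size z + 1 \<and> 2 * z ! 0 < v + clique_size z + 1 \<and> u \<noteq> v then deg_num z
      else 0)"

definition out_den :: "word \<Rightarrow> nat \<Rightarrow> nat \<Rightarrow> nat" where
  "out_den z u v =
     (if u < z ! 0 \<and> v < z ! 0 then wden z (z ! 0 * u + v)
      else if 2 * z ! 0 < u + clique_size z + 1 \<and> 2 * z ! 0 < v + clique_size z + 1 \<and> u \<noteq> v
      then deg_den z * (clique_size z - 1) else 1)"

definition fds_word :: "word \<Rightarrow> word" where
  "fds_word z = map (\<lambda>j.
     if j = 0 then 2 * z ! 0
     else if j \<le> 8 * (z ! 0)^2 then
       (let i = (j - 1) div 2; u = i div (2 * z ! 0); v = i mod (2 * z ! 0)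
        in if odd j then out_num z u v else out_den z u v)
     else if j - (1 + 8 * (z ! 0)^2) < z ! 0 then 1 else 0)
   [0..<1 + 8 * (z ! 0)^2 + 2 * z ! 0]"

text \<open>Only the positions of red vertices are read. The guard on the length matters because the
  deciding program must halt on every \<open>y\<close>, not just on correct answers.\<close>

definition selected :: "word \<Rightarrow> word \<Rightarrow> nat set" where
  "selected z y = {v. v < z ! 0 \<and> v < length y \<and> y ! v \<noteq> 0}"

definition sel_pair :: "word \<Rightarrow> word \<Rightarrow> nat \<Rightarrow> bool" where
  "sel_pair z y i \<longleftrightarrow> i div z ! 0 \<in> selected z y \<and> i mod z ! 0 \<in> selected z y"

text \<open>
  With \<open>A / B = d\<close>, \<open>C / D = x(R)\<close> and \<open>\<eta> = 1 / N\<close>, the last inequality is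
  \<open>(1 + 2 \<eta>) d k < x(R) + d l\<^sup>2 / t\<close> with denominators cleared.
\<close>

definition accepts :: "nat \<Rightarrow> word \<Rightarrow> word \<Rightarrow> bool" where
  "accepts N z y \<longleftrightarrow>
     (let A = deg_num z; B = deg_den z; t = clique_size z; k = card (selected z y); l = min k t;
          C = frac_num (wnum z) (wden z) (sel_pair z y) (z ! 0 * z ! 0);
          D = frac_den (wden z) (sel_pair z y) (z ! 0 * z ! 0)
      in q * t = p * z ! 0 \<and> 2 \<le> t \<and> A * D * (N + 2) * k * t < C * B * N * t + A * D * N * (l * l))"

end

lemma clique_size_le: "p \<le> q \<Longrightarrow> clique_size p q z \<le> z ! 0"
proof (cases "q = 0")
  case False
  assume "p \<le> q"
  then have "p * z ! 0 div q \<le> q * z ! 0 div q" by (intro div_le_mono mult_le_mono) auto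
  then show ?thesis using False by (simp add: clique_size_def)
qed (simp add: clique_size_def)

lemma length_fds_word: "length (fds_word p q z) = 1 + 8 * (z ! 0)^2 + 2 * z ! 0"
  by (simp add: fds_word_def)

lemma sum_square:
  fixes f :: "nat \<Rightarrow> nat \<Rightarrow> real"
  shows "(\<Sum>i<n * n. f (i div n) (i mod n)) = (\<Sum>u<n. \<Sum>v<n. f u v)"
proof -
  have "(\<Sum>u<n. \<Sum>v<n. f u v) = (\<Sum>p\<in>{..<n} \<times> {..<n}. f (fst p) (snd p))"
    by (simp add: sum.cartesian_product case_prod_beta)
  also have "\<dots> = (\<Sum>i<n * n. f (i div n) (i mod n))"
    by (rule sum.reindex_bij_witness[of _ "\<lambda>i. (i div n, i mod n)" "\<lambda>p. n * fst p + snd p"])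
      (auto simp: index_less less_mult_imp_div_less intro!: mod_less_divisor gr0I)
  finally show ?thesis by simp
qed

lemma selected_subset: "selected z y \<subseteq> {..<z ! 0}"
  by (auto simp: selected_def)

lemma selected_frac:
  assumes "graph_word z n"
  shows "real (frac_num (wnum z) (wden z) (sel_pair z y) (n * n)) / real (frac_den (wden z) (sel_pair z y) (n * n))
    = qsum (wmat z) (selected z y)"
proof -
  define R where "R = selected z y"
  have n: "z ! 0 = n" using assms by (simp add: graph_word_def)
  have R: "R \<subseteq> {..<n}" using selected_subset[of z y] n by (simp add: R_def)
  have "real (frac_num (wnum z) (wden z) (sel_pair z y) (n * n)) / real (frac_den (wden z) (sel_pair z y) (n * n))
    = (\<Sum>i<n * n. if sel_pair z y i then real (wnum z i) / real (wden z i) else 0)"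
    using assms by (intro frac_eq_sum) (auto simp: graph_word_def)
  also have "\<dots> = (\<Sum>i<n * n. if i div n \<in> R \<and> i mod n \<in> R then wmat z (i div n) (i mod n) else 0)"
    by (rule sum.cong) (auto simp: sel_pair_def wmat_def n R_def)
  also have "\<dots> = (\<Sum>u<n. \<Sum>v<n. if u \<in> R \<and> v \<in> R then wmat z u v else 0)" by (rule sum_square)
  also have "\<dots> = (\<Sum>u<n. if u \<in> R then (\<Sum>v<n. if v \<in> R then wmat z u v else 0) else 0)"
    by (rule sum.cong) auto
  also have "\<dots> = qsum (wmat z) R" unfolding qsum_def
    using R by (simp add: sum.inter_restrict[symmetric] Int_absorb1)
  finally show ?thesis by (simp add: R_def)
qed

lemma degree_frac:
  assumes "graph_word z n" "0 < n"
  shows "real (deg_num z) / real (deg_den z) = (\<Sum>v<n. wmat z 0 v)" "0 < deg_den z"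
proof -
  have b: "i < n \<Longrightarrow> wden z i \<noteq> 0" for i
    using assms index_less[of 0 n i] by (simp add: graph_word_def)
  have "real (deg_num z) / real (deg_den z) =
    (\<Sum>i<n. if True then real (wnum z i) / real (wden z i) else 0)"
    unfolding deg_num_def deg_den_def using assms(1) b by (subst frac_eq_sum) (auto simp: graph_word_def)
  then show "real (deg_num z) / real (deg_den z) = (\<Sum>v<n. wmat z 0 v)"
    by (simp add: wmat_def)
  show "0 < deg_den z" unfolding deg_den_def using assms(1) b by (intro frac_den_pos) (auto simp: graph_word_def)
qed

lemma sse_instance_matrix:
  assumes "sse_instance z G d"
  obtains n where "graph_word z n" "0 < n" "verts G = {..<n}" "regular_matrix {..<n} (wmat z) d"
    "\<forall>S\<subseteq>{..<n}. qsum (wmat z) S = qsum (adj G) S" "real (deg_num z) / real (deg_den z) = d"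
    "0 < deg_den z"
proof -
  obtain n where n: "verts G = {..<n}" "graph_word z n" "\<And>u v. u < n \<Longrightarrow> v < n \<Longrightarrow> wmat z u v = adj G u v"
    using assms unfolding sse_instance_def encodes_graph_iff by blast
  have G: "wgraph G" "regular G d" "0 < d" "0 < n"
    using assms n by (auto simp: sse_instance_def)
  interpret regular_matrix "verts G" "adj G" d by (rule regular_matrix_adj) fact+
  have reg: "regular_matrix {..<n} (wmat z) d"
    using n(3) nonneg sym diag row_sum d_pos by unfold_locales (auto simp: n(1))
  interpret W: regular_matrix "{..<n}" "wmat z" d by (rule reg)
  show thesis
    by (rule that[OF n(2) G(4) n(1) reg])
      (use degree_frac[OF n(2) G(4)] W.row_sum[of 0] G(4) n(3) in \<open>auto simp: qsum_def intro!: sum.cong\<close>)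
qed

section \<open>The constructed graph as a matrix and as a word\<close>

definition fds_matrix :: "(nat \<Rightarrow> nat \<Rightarrow> real) \<Rightarrow> nat \<Rightarrow> nat \<Rightarrow> real \<Rightarrow> nat \<Rightarrow> nat \<Rightarrow> real" where
  "fds_matrix a n t d u v =
     (if u < n \<and> v < n then a u v
      else if 2 * n < u + t + 1 \<and> 2 * n < v + t + 1 \<and> u \<noteq> v then d / (real t - 1) else 0)"

definition fds_matrix_word :: "nat \<Rightarrow> nat \<Rightarrow> word \<Rightarrow> word" where
  "fds_matrix_word p q z = take (1 + 8 * (z ! 0)^2) (fds_word p q z)"

definition colour_word :: "nat \<Rightarrow> word" where
  "colour_word n = map (\<lambda>v. if v < n then 1 else 0) [0..<2 * n]"

lemma fds_word_split: "fds_word p q z = fds_matrix_word p q z @ colour_word (z ! 0)"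
proof -
  have "drop (1 + 8 * (z ! 0)^2) (fds_word p q z) = colour_word (z ! 0)"
    by (rule nth_equalityI) (auto simp: length_fds_word colour_word_def fds_word_def simp del: upt_Suc)
  then show ?thesis unfolding fds_matrix_word_def by (metis append_take_drop_id)
qed

lemma length_fds_matrix_word: "length (fds_matrix_word p q z) = 1 + 2 * (2 * z ! 0)^2"
  by (simp add: fds_matrix_word_def length_fds_word power_mult_distrib)

lemma fds_matrix_word_nth:
  fixes z :: word
  defines "n \<equiv> z ! 0"
  assumes "u < 2 * n" "v < 2 * n"
  shows "wnum (fds_matrix_word p q z) (2 * n * u + v) = out_num p q z u v"
    and "wden (fds_matrix_word p q z) (2 * n * u + v) = out_den p q z u v"
proof -
  define i where "i = 2 * n * u + v"
  have "i < (2 * n) * (2 * n)" unfolding i_def using index_less[OF assms(2,3)] .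
  then have i: "1 + 2 * i < 8 * n^2" "2 + 2 * i < 1 + 8 * n^2" by (auto simp: power2_eq_square)
  have d: "i div (2 * n) = u" "i mod (2 * n) = v" using assms by (simp_all add: i_def)
  have "(2 + 2 * i - 1) div 2 = i" "(1 + 2 * i - 1) div 2 = i" by simp_all
  then show "wnum (fds_matrix_word p q z) (2 * n * u + v) = out_num p q z u v"
    "wden (fds_matrix_word p q z) (2 * n * u + v) = out_den p q z u v"
    unfolding i_def[symmetric] fds_matrix_word_def fds_word_def n_def[symmetric] using i d
    by (simp_all add: Let_def del: upt_Suc)
qed

lemma fds_matrix_word_0: "fds_matrix_word p q z ! 0 = 2 * z ! 0"
  by (simp add: fds_matrix_word_def fds_word_def)

section \<open>Fair sets of the constructed graph\<close>

locale sse_word =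
  fixes z :: word and n :: nat and d :: real and p q :: nat
  assumes gw: "graph_word z n" and n_pos: "0 < n"
    and reg: "regular_matrix {..<n} (wmat z) d"
    and deg: "real (deg_num z) / real (deg_den z) = d" and deg_den: "0 < deg_den z"
    and pq: "p \<le> q"
begin

sublocale regular_matrix "{..<n}" "wmat z" d by (rule reg)

lemma z0: "z ! 0 = n" using gw by (simp add: graph_word_def)

abbreviation "t \<equiv> clique_size p q z"
abbreviation "bm \<equiv> fds_matrix (wmat z) n t d"

lemma t_le: "t \<le> n" using clique_size_le[OF pq, of z] by (simp add: z0)

text \<open>Whenever a clique entry of the matrix is used, its denominator \<open>t - 1\<close> is
  nonzero.\<close>

lemma clique_two: "u < 2 * n \<Longrightarrow> v < 2 * n \<Longrightarrow> 2 * n < u + t + 1 \<Longrightarrow> 2 * n < v + t + 1 \<Longrightarrow> u \<noteq> v \<Longrightarrow> 2 \<le> t"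
  by linarith

lemma graph_word_fds: "graph_word (fds_matrix_word p q z) (2 * n)"
  unfolding graph_word_iff
proof (intro conjI allI impI)
  fix u v assume uv: "u < 2 * n" "v < 2 * n"
  have "out_den p q z u v \<noteq> 0"
    using gw index_less[of u n v] deg_den uv clique_two[OF uv] by (auto simp: out_den_def graph_word_def)
  then show "wden (fds_matrix_word p q z) (2 * n * u + v) \<noteq> 0"
    using fds_matrix_word_nth(2)[of u z v p q] uv by (simp add: z0)
qed (use length_fds_matrix_word[of p q z] fds_matrix_word_0[of p q z] z0 in auto)

lemma wmat_fds:
  assumes "u < 2 * n" "v < 2 * n"
  shows "wmat (fds_matrix_word p q z) u v = bm u v"
proof -
  have "wmat (fds_matrix_word p q z) u v = real (out_num p q z u v) / real (out_den p q z u v)"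
    using fds_matrix_word_nth[of u z v p q] assms
    by (simp add: wmat_def fds_matrix_word_0 z0)
  also have "\<dots> = bm u v"
    using clique_two[OF assms] deg by (auto simp: out_num_def out_den_def fds_matrix_def wmat_def z0 of_nat_diff field_simps)
  finally show ?thesis .
qed

lemma bm_sym: "bm u v = bm v u" using sym by (auto simp: fds_matrix_def)

lemma bm_diag: "bm u u = 0" using diag by (auto simp: fds_matrix_def)

lemma bm_nonneg: "u < 2 * n \<Longrightarrow> v < 2 * n \<Longrightarrow> 0 \<le> bm u v"
  using nonneg d_pos clique_two[of u v] by (auto simp: fds_matrix_def)

lemma fds_word_instance: "fds_word p q z \<in> fds_instances"
proof -
  \<comment> \<open>Every pair is made an edge, possibly of weight 0, so that \<open>adj G\<close>
    is \<open>bm\<close> without case distinctions. \<open>Min\<close> and \<open>Max\<close>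
    recover the endpoints from the edge, their order being irrelevant by symmetry.\<close>
  define G :: "nat cgraph" where
    "G = \<lparr>verts = {..<2 * n}, edges = {{u, v} | u v. u < 2 * n \<and> v < 2 * n \<and> u \<noteq> v},
          wt = (\<lambda>e. bm (Min e) (Max e)), col = (\<lambda>v. if v < n then Red else Blue)\<rparr>"
  have adj: "adj G u v = bm u v" if "u < 2 * n" "v < 2 * n" for u v
  proof -
    have "{u, v} \<in> edges G \<longleftrightarrow> u \<noteq> v" using that by (auto simp: G_def doubleton_eq_iff)
    moreover have "wt G {u, v} = bm u v" using bm_sym[of u v] by (auto simp: G_def min_def max_def)
    ultimately show ?thesis by (auto simp: adj_def bm_diag)
  qed
  have "wgraph G"
    unfolding wgraph_def
  proof (intro conjI ballI)
    fix e assume "e \<in> edges G"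
    then obtain u v where e: "e = {u, v}" "u < 2 * n" "v < 2 * n" "u \<noteq> v" by (auto simp: G_def)
    show "e \<subseteq> verts G" "card e = 2" using e by (auto simp: G_def)
    have "wt G e = bm (Min e) (Max e)" by (simp add: G_def)
    then show "0 \<le> wt G e" using bm_nonneg[of "Min e" "Max e"] e by (auto simp: min_def max_def)
  qed (simp add: G_def)
  moreover have "encodes_graph (fds_matrix_word p q z) G"
    unfolding encodes_graph_iff
    by (rule exI[of _ "2 * n"]) (use graph_word_fds wmat_fds adj in \<open>simp add: G_def\<close>)
  then have "encodes_cgraph (fds_word p q z) G"
    unfolding encodes_cgraph_def
    by (intro exI[of _ "fds_matrix_word p q z"]) (simp add: fds_word_split colour_word_def z0 G_def)
  moreover have "fair G (verts G)"
  proof -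
    have "{v \<in> verts G. col G v = Red} = {..<n}" "{v \<in> verts G. col G v = Blue} = {n..<2 * n}"
      by (auto simp: G_def split: if_splits)
    then show ?thesis by (simp add: fair_def)
  qed
  ultimately show ?thesis
    using n_pos unfolding fds_instances_def fds_instance_def by (auto simp: G_def lessThan_empty_iff)
qed

text \<open>\<open>fds_answer\<close> speaks of some graph encoded by the word, not of the one just
  built. The leading entry fixes where the matrix ends, so all such graphs share weights and
  colours; they can differ only in edges of weight 0.\<close>

lemma fds_instance_decode:
  assumes "fds_instance (fds_word p q z) G"
  shows "wgraph G" "verts G = {..<2 * n}"
    "\<And>u v. u < 2 * n \<Longrightarrow> v < 2 * n \<Longrightarrow> adj G u v = bm u v"
    "\<And>v. v < 2 * n \<Longrightarrow> col G v = Red \<longleftrightarrow> v < n"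
proof -
  obtain y where y: "encodes_graph y G"
    "fds_word p q z = y @ map (\<lambda>v. if col G v = Red then 1 else 0) [0..<card (verts G)]"
    using assms by (auto simp: fds_instance_def encodes_cgraph_def)
  obtain m where m: "verts G = {..<m}" "graph_word y m" "\<forall>u<m. \<forall>v<m. wmat y u v = adj G u v"
    using y(1) encodes_graph_iff by blast
  have "y \<noteq> []" using m(2) by (auto simp: graph_word_def)
  then have "y ! 0 = fds_matrix_word p q z ! 0"
    using y(2) fds_word_split[of p q z] length_fds_matrix_word[of p q z]
    by (metis length_greater_0_conv nth_append add_gr_0 zero_less_one)
  then have mn: "m = 2 * n" using m(2) by (simp add: graph_word_def fds_matrix_word_0 z0)
  have "length y = length (fds_matrix_word p q z)"
    using m(2) by (simp add: graph_word_def length_fds_matrix_word mn z0)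
  then have eq: "y = fds_matrix_word p q z"
    "map (\<lambda>v. if col G v = Red then 1 else 0) [0..<2 * n] = colour_word n"
    using y(2) fds_word_split[of p q z] by (auto simp: m(1) mn z0)
  show "wgraph G" using assms by (simp add: fds_instance_def)
  show "verts G = {..<2 * n}" using m mn by simp
  show "adj G u v = bm u v" if "u < 2 * n" "v < 2 * n" for u v
    using m(3) that wmat_fds[OF that] by (simp add: eq(1) mn)
  show "col G v = Red \<longleftrightarrow> v < n" if "v < 2 * n" for v
  proof -
    have "(if col G v = Red then 1 else 0 :: nat) = (if v < n then 1 else 0)"
      using eq(2) that by (simp add: colour_word_def)
    then show ?thesis by (simp split: if_splits)
  qed
qed

text \<open>No weight runs between red and blue, and blue vertices outside the clique are isolated.
  What remains are the red pairs and the ordered pairs of distinct clique vertices in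
  \<open>S\<close>.\<close>

lemma qsum_bm:
  assumes S: "S \<subseteq> {..<2 * n}"
  shows "qsum bm S = qsum (wmat z) (S \<inter> {..<n}) +
    real (card (S \<inter> {2 * n - t..<2 * n})) * (real (card (S \<inter> {2 * n - t..<2 * n})) - 1) * (d / (real t - 1))"
proof -
  define R where "R = S \<inter> {..<n}"
  define B where "B = S \<inter> {n..<2 * n}"
  define C where "C = S \<inter> {2 * n - t..<2 * n}"
  have fin: "finite R" "finite B" "finite C" by (auto simp: R_def B_def C_def)
  have RB: "S = R \<union> B" "R \<inter> B = {}" using S by (auto simp: R_def B_def)
  have CB: "C \<subseteq> B" using t_le by (auto simp: B_def C_def)
  have R: "(\<Sum>v\<in>S. bm u v) = (\<Sum>v\<in>R. wmat z u v)" if "u \<in> R" for u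
  proof -
    have "(\<Sum>v\<in>B. bm u v) = 0"
      by (rule sum.neutral) (use that t_le in \<open>auto simp: fds_matrix_def R_def B_def\<close>)
    moreover have "(\<Sum>v\<in>R. bm u v) = (\<Sum>v\<in>R. wmat z u v)"
      by (rule sum.cong) (use that in \<open>auto simp: fds_matrix_def R_def\<close>)
    ultimately show ?thesis unfolding RB(1) using fin RB(2) by (simp add: sum.union_disjoint)
  qed
  have B: "(\<Sum>v\<in>S. bm u v) = (if u \<in> C then (real (card C) - 1) * (d / (real t - 1)) else 0)" if "u \<in> B" for u
  proof -
    have "(\<Sum>v\<in>S. bm u v) = (\<Sum>v\<in>S. if v \<in> (if u \<in> C then C - {u} else {}) then d / (real t - 1) else 0)"
      by (rule sum.cong) (use that S t_le in \<open>auto simp: fds_matrix_def B_def C_def\<close>)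
    also have "\<dots> = (\<Sum>v\<in>S \<inter> (if u \<in> C then C - {u} else {}). d / (real t - 1))"
      using S by (subst sum.inter_restrict) (auto intro: finite_subset)
    also have "S \<inter> (if u \<in> C then C - {u} else {}) = (if u \<in> C then C - {u} else {})"
      by (auto simp: C_def)
    finally show ?thesis using fin card_gt_0_iff[of C] by (auto simp: of_nat_diff card_Diff_singleton Suc_le_eq)
  qed
  have "qsum bm S = (\<Sum>u\<in>R. \<Sum>v\<in>S. bm u v) + (\<Sum>u\<in>B. \<Sum>v\<in>S. bm u v)"
    unfolding qsum_def by (subst (1) RB(1)) (use fin RB(2) in \<open>simp add: sum.union_disjoint\<close>)
  also have "\<dots> = qsum (wmat z) R + (\<Sum>u\<in>B. if u \<in> C then (real (card C) - 1) * (d / (real t - 1)) else 0)"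
    using R B by (simp add: qsum_def)
  also have "(\<Sum>u\<in>B. if u \<in> C then (real (card C) - 1) * (d / (real t - 1)) else 0)
     = real (card C) * ((real (card C) - 1) * (d / (real t - 1)))"
    using fin CB by (simp add: sum.inter_restrict[symmetric] Int_absorb1)
  finally show ?thesis by (simp add: R_def C_def algebra_simps)
qed

lemma density_eq:
  assumes G: "fds_instance (fds_word p q z) G" and S: "S \<subseteq> {..<2 * n}"
  shows "density G S = qsum bm S / (2 * card S)"
proof -
  note dec = fds_instance_decode[OF G]
  have "qsum (adj G) S = qsum bm S" unfolding qsum_def using S dec(3) by (intro sum.cong) auto
  then have e: "(\<Sum>e | e \<in> edges G \<and> e \<subseteq> S. wt G e) = qsum bm S / 2"
    using inner_weight_eq_qsum[OF dec(1) finite_subset[OF S]] by simp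
  show ?thesis unfolding density_def e by simp
qed

lemma fair_iff:
  assumes G: "fds_instance (fds_word p q z) G" and S: "S \<subseteq> {..<2 * n}"
  shows "fair G S \<longleftrightarrow> card (S \<inter> {..<n}) = card (S \<inter> {n..<2 * n})"
proof -
  note dec = fds_instance_decode(4)[OF G]
  have "{v \<in> S. col G v = Red} = S \<inter> {..<n}" using dec S by auto
  moreover have "col G v = Blue \<longleftrightarrow> \<not> v < n" if "v < 2 * n" for v
    using dec[OF that] by (cases "col G v") auto
  then have "{v \<in> S. col G v = Blue} = S \<inter> {n..<2 * n}" using S by auto
  ultimately show ?thesis by (simp add: fair_def)
qed

text \<open>The denominator 4 comes from halving twice: ordered pairs count each edge two times, and
  \<open>S\<close> together with the clique has \<open>2 * t\<close> vertices.\<close>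

lemma opt_density_ge:
  assumes G: "fds_instance (fds_word p q z) G" and t: "2 \<le> t"
    and S: "S \<subseteq> {..<n}" "card S = t" "qsum (wmat z) S \<ge> (1 - \<eta>) * d * t"
  shows "opt_density G \<ge> (2 - \<eta>) * d / 4"
proof -
  define C where "C = {2 * n - t..<2 * n}"
  define X where "X = S \<union> C"
  have cC: "card C = t" using t_le by (simp add: C_def)
  have X: "X \<subseteq> {..<2 * n}" using S by (auto simp: X_def C_def)
  have int: "X \<inter> {..<n} = S" "X \<inter> {n..<2 * n} = C" "X \<inter> {2 * n - t..<2 * n} = C"
    using S t_le by (auto simp: X_def C_def)
  have "card X = 2 * t" unfolding X_def using S t_le cC finite_sub
    by (subst card_Un_disjoint) (auto simp: C_def)
  have "qsum bm X \<ge> (1 - \<eta>) * d * t + real t * (real t - 1) * (d / (real t - 1))"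
    unfolding qsum_bm[OF X] int cC using S(3) by simp
  also have "real t * (real t - 1) * (d / (real t - 1)) = t * d" using t by simp
  finally have q: "qsum bm X \<ge> (2 - \<eta>) * d * t" by (simp add: algebra_simps)
  have "(2 - \<eta>) * d / 4 = (2 - \<eta>) * d * t / (2 * card X)" using t \<open>card X = 2 * t\<close> by simp
  also have "\<dots> \<le> qsum bm X / (2 * card X)" using q by (rule divide_right_mono) simp
  also have "\<dots> = density G X" using density_eq[OF G X] by simp
  also have "\<dots> \<le> opt_density G" unfolding opt_density_def
  proof (rule Max_ge)
    have "feasible G \<subseteq> Pow {..<2 * n}" using fds_instance_decode(2)[OF G] by (auto simp: feasible_def)
    then show "finite (density G ` feasible G)" by (auto intro: finite_subset)
    have "X \<noteq> {}" using \<open>card X = 2 * t\<close> t by auto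
    then show "density G X \<in> density G ` feasible G"
      using X fds_instance_decode(2)[OF G] fair_iff[OF G X] int S cC by (auto simp: feasible_def)
  qed
  finally show ?thesis .
qed

text \<open>If \<open>c\<close> clique vertices are chosen, they contribute
  \<open>d * c * (c - 1) / (t - 1)\<close>, at most \<open>d * c\<^sup>2 / t\<close> because
  \<open>c \<le> t\<close>. Fairness gives \<open>c \<le> k\<close>, so the blue part of the answer
  can be eliminated and the red part alone is left to be tested. \<open>\<theta>\<close> measures
  density in units of \<open>d / 4\<close>.\<close>

lemma answer_ge:
  assumes G: "fds_instance (fds_word p q z) G" and t: "2 \<le> t"
    and S: "S \<in> feasible G" "density G S \<ge> \<theta> * d / 4"
  shows "qsum (wmat z) (S \<inter> {..<n}) + d * (real (min (card (S \<inter> {..<n})) t))\<^sup>2 / t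
      \<ge> \<theta> * d * card (S \<inter> {..<n})"
    and "0 < card (S \<inter> {..<n})"
proof -
  define k where "k = card (S \<inter> {..<n})"
  define B where "B = S \<inter> {n..<2 * n}"
  define C where "C = S \<inter> {2 * n - t..<2 * n}"
  have SV: "S \<subseteq> {..<2 * n}" "S \<noteq> {}" "fair G S"
    using S fds_instance_decode(2)[OF G] by (auto simp: feasible_def)
  have kB: "card B = k" using fair_iff[OF G SV(1)] SV(3) by (simp add: k_def B_def)
  have cS: "card S = 2 * k"
  proof -
    have "S = (S \<inter> {..<n}) \<union> B" using SV by (auto simp: B_def)
    moreover have "card ((S \<inter> {..<n}) \<union> B) = card (S \<inter> {..<n}) + card B"
      by (rule card_Un_disjoint) (auto simp: B_def)
    ultimately have "card S = card (S \<inter> {..<n}) + card B" by simp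
    then show ?thesis using kB by (simp add: k_def)
  qed
  have k0: "0 < k" using cS SV finite_subset[OF SV(1)] by (auto intro: gr0I)
  then show "0 < card (S \<inter> {..<n})" by (simp add: k_def)
  define c where "c = real (card C)"
  define l where "l = real (min k t)"
  define T where "T = real t"
  have "C \<subseteq> B" using t_le by (auto simp: B_def C_def)
  then have "card C \<le> k" using kB card_mono[of B C] by (simp add: B_def)
  moreover have "card C \<le> t" using card_mono[of "{2 * n - t..<2 * n}" C] t_le by (simp add: C_def)
  ultimately have cl: "c \<le> l" "c \<le> T" "l \<le> T" by (auto simp: c_def l_def T_def)
  have T: "T \<ge> 2" using t by (simp add: T_def)
  have c0: "0 \<le> c" by (simp add: c_def)
  have "c * (c - 1) / (T - 1) \<le> l\<^sup>2 / T"
  proof -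
    have "T * (c - 1) \<le> c * (T - 1)" using cl by (simp add: algebra_simps)
    then have "c * (T * (c - 1)) \<le> c * (c * (T - 1))" using c0 by (rule mult_left_mono)
    then have "c * (c - 1) / (T - 1) \<le> c\<^sup>2 / T" using T by (simp add: field_simps power2_eq_square)
    also have "\<dots> \<le> l\<^sup>2 / T" using cl c0 T by (intro divide_right_mono power_mono) auto
    finally show ?thesis .
  qed
  then have le: "d * (c * (c - 1) / (T - 1)) \<le> d * (l\<^sup>2 / T)" using d_pos by (intro mult_left_mono) auto
  have "\<theta> * d / 4 \<le> qsum bm S / (4 * real k)"
    using S(2) density_eq[OF G SV(1)] cS by simp
  then have "\<theta> * d * k \<le> qsum bm S" using k0 by (simp add: field_simps)
  also have "\<dots> = qsum (wmat z) (S \<inter> {..<n}) + d * (c * (c - 1) / (T - 1))"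
    unfolding qsum_bm[OF SV(1)] by (simp add: c_def C_def T_def)
  also have "\<dots> \<le> qsum (wmat z) (S \<inter> {..<n}) + d * l\<^sup>2 / T" using le by simp
  finally show "qsum (wmat z) (S \<inter> {..<n}) + d * (real (min (card (S \<inter> {..<n})) t))\<^sup>2 / t
      \<ge> \<theta> * d * card (S \<inter> {..<n})" by (simp add: k_def l_def T_def)
qed

lemma accepts_iff:
  assumes N: "0 < N"
  shows "accepts p q N z y \<longleftrightarrow> q * t = p * n \<and> 2 \<le> t \<and>
    (1 + 2 / N) * d * card (selected z y) <
      qsum (wmat z) (selected z y) + d * (real (min (card (selected z y)) t))\<^sup>2 / t"
proof -
  define k where "k = card (selected z y)"
  define l where "l = min k t"
  define A where "A = deg_num z"
  define B where "B = deg_den z"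
  define C where "C = frac_num (wnum z) (wden z) (sel_pair z y) (n * n)"
  define D where "D = frac_den (wden z) (sel_pair z y) (n * n)"
  have D: "0 < D" unfolding D_def using gw by (intro frac_den_pos) (auto simp: graph_word_def)
  have B: "0 < B" using deg_den by (simp add: B_def)
  have x: "qsum (wmat z) (selected z y) = C / D" using selected_frac[OF gw, of y] by (simp add: C_def D_def)
  have dd: "d = A / B" using deg by (simp add: A_def B_def)
  have "A * D * (N + 2) * k * t < C * B * N * t + A * D * N * (l * l) \<longleftrightarrow>
    (1 + 2 / N) * d * k < qsum (wmat z) (selected z y) + d * (real l)\<^sup>2 / t" if t: "2 \<le> t"
  proof -
    \<comment> \<open>\<open>F\<close> clears the denominators \<open>B\<close> of the degree,
      \<open>D\<close> of the red weight, \<open>N\<close> of \<open>\<eta>\<close>, and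
      \<open>t\<close>.\<close>
    define F where "F = real B * real D * real N * real t"
    have F: "0 < F" using B D N t by (simp add: F_def)
    have "A * D * (N + 2) * k * t < C * B * N * t + A * D * N * (l * l) \<longleftrightarrow>
      real (A * D * (N + 2) * k * t) < real (C * B * N * t + A * D * N * (l * l))"
      by (rule of_nat_less_iff[symmetric])
    also have "real (A * D * (N + 2) * k * t) = F * ((1 + 2 / N) * d * k)"
      using B D N t by (simp add: F_def dd field_simps)
    also have "real (C * B * N * t + A * D * N * (l * l)) =
      F * (qsum (wmat z) (selected z y) + d * (real l)\<^sup>2 / t)"
      using B D N t by (simp add: F_def dd x field_simps power2_eq_square)
    finally show ?thesis by (simp only: mult_less_cancel_left_pos[OF F])
  qed
  then show ?thesis
    unfolding accepts_def Let_def z0 by (auto simp: k_def l_def A_def B_def C_def D_def)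
qed

end

section \<open>The test on the two sides of the promise\<close>

lemma sse_word_of_instance:
  assumes "sse_instance z G d" "p \<le> q"
  obtains n where "sse_word z n d p q" "verts G = {..<n}"
    "\<forall>S\<subseteq>{..<n}. qsum (wmat z) S = qsum (adj G) S"
proof -
  obtain n where "graph_word z n" "0 < n" "verts G = {..<n}" "regular_matrix {..<n} (wmat z) d"
    "\<forall>S\<subseteq>{..<n}. qsum (wmat z) S = qsum (adj G) S" "real (deg_num z) / real (deg_den z) = d"
    "0 < deg_den z"
    by (rule sse_instance_matrix[OF assms(1)])
  then show thesis using assms(2) by (intro that[of n]) (simp_all add: sse_word_def)
qed

text \<open>The tested inequality contradicts \<open>qsum_soundness\<close> for any \<open>y\<close>
  whatsoever. If \<open>\<delta> * n\<close> is not an integer, the promise says nothing about any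
  set; then the equation \<open>q * t = p * n\<close> in \<open>accepts\<close> fails, and otherwise
  it makes the sets of size \<open>t\<close> the ones the promise speaks of.\<close>

lemma sse_no_rejects:
  assumes z: "z \<in> sse_no (1 / real N) (real p / real q)" and N: "0 < N" and hpq: "p \<le> q" "0 < q"
  shows "\<not> accepts p q N z y"
proof
  assume acc: "accepts p q N z y"
  obtain G d where G: "sse_instance z G d"
    and no: "\<And>S. S \<subseteq> verts G \<Longrightarrow> real (card S) = real p / real q * real (card (verts G)) \<Longrightarrow>
      expansion G d S \<ge> 1 - 1 / N"
    using z by (auto simp: sse_no_def)
  obtain n where sw: "sse_word z n d p q" and V: "verts G = {..<n}"
    and qe: "\<forall>S\<subseteq>{..<n}. qsum (wmat z) S = qsum (adj G) S"
    by (rule sse_word_of_instance[OF G hpq(1)])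
  interpret sse_word z n d p q by (rule sw)
  have wG: "wgraph G" "regular_matrix (verts G) (adj G) d"
    using G regular_matrix_adj by (auto simp: sse_instance_def)
  have acc': "q * t = p * n" "2 \<le> t" "(1 + 2 / N) * d * card (selected z y) <
      qsum (wmat z) (selected z y) + d * (real (min (card (selected z y)) t))\<^sup>2 / t"
    using acc unfolding accepts_iff[OF N] by blast+
  have "qsum (wmat z) S \<le> 1 / N * d * t" if S: "S \<subseteq> {..<n}" "card S = t" for S
  proof -
    have "real q * real t = real p * real n" using arg_cong[OF acc'(1), of real] by simp
    moreover have "real q \<noteq> 0" using hpq by simp
    ultimately have "real (card S) = real p / real q * real (card (verts G))"
      using S(2) V by (simp add: eq_divide_eq mult.commute)
    then have e: "expansion G d S \<ge> 1 - 1 / N" using no[of S] S(1) V by simp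
    have "S \<noteq> {}" using S(2) acc'(2) by auto
    then have "expansion G d S = 1 - qsum (wmat z) S / (d * t)"
      using expansion_eq[OF wG, of S] S V qe by simp
    then have "qsum (wmat z) S / (d * t) \<le> 1 / N" using e by simp
    moreover have "0 < d * t" using d_pos acc'(2) by simp
    ultimately show ?thesis by (simp add: pos_divide_le_eq mult.assoc)
  qed
  then have "qsum (wmat z) (selected z y) + d * (real (min (card (selected z y)) t))\<^sup>2 / t
      \<le> (1 + 2 * (1 / N)) * d * card (selected z y)"
    using t_le N selected_subset[of z y] acc'(2) by (intro qsum_soundness) (auto simp: z0)
  then show False using acc'(3) by simp
qed

lemma sse_yes_accepts:
  assumes z: "z \<in> sse_yes (1 / real N) (real p / real q)" and N: "1 < N" and hpq: "p \<le> q" "0 < p"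
    and \<epsilon>: "5 / real N < \<epsilon>" "\<epsilon> < 2"
    and ans: "fds_answer (2 - \<epsilon>) (fds_word p q z) y"
  shows "accepts p q N z y"
proof -
  obtain G d S where G: "sse_instance z G d" and S: "S \<subseteq> verts G"
      "real (card S) = real p / real q * real (card (verts G))" "expansion G d S \<le> 1 / N"
    using z by (auto simp: sse_yes_def)
  obtain n where sw: "sse_word z n d p q" and V: "verts G = {..<n}"
    and qe: "\<forall>S\<subseteq>{..<n}. qsum (wmat z) S = qsum (adj G) S"
    by (rule sse_word_of_instance[OF G hpq(1)])
  interpret sse_word z n d p q by (rule sw)
  have wG: "wgraph G" "regular_matrix (verts G) (adj G) d"
    using G regular_matrix_adj by (auto simp: sse_instance_def)
  have "real q * real (card S) = real p * real n" using S(2) V hpq by (simp add: field_simps)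
  then have qS: "q * card S = p * n" by (simp flip: of_nat_mult)
  then have cS: "card S = t" using hpq by (simp add: clique_size_def z0 flip: qS)
  have "q * card S \<noteq> 0" using qS hpq n_pos by simp
  then have t0: "0 < t" using cS by simp
  then have "S \<noteq> {}" using cS by auto
  then have "expansion G d S = 1 - qsum (wmat z) S / (d * t)"
    using expansion_eq[OF wG S(1)] S(1) V cS qe by simp
  then have "1 - 1 / N \<le> qsum (wmat z) S / (d * t)" using S(3) by simp
  moreover have "0 < d * t" using d_pos t0 by simp
  ultimately have big: "qsum (wmat z) S \<ge> (1 - 1 / N) * d * t" by (simp add: pos_le_divide_eq mult.assoc)
  have t2: "2 \<le> t"
  proof (rule ccontr)
    assume "\<not> 2 \<le> t"
    then have "card S = 1" using t0 cS by simp
    then obtain v where "S = {v}" by (auto simp: card_1_singleton_iff)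
    then have "qsum (wmat z) S = 0" using diag S V by (simp add: qsum_def)
    moreover have "0 < (1 - 1 / N) * d * t" using d_pos t0 N by simp
    ultimately show False using big by simp
  qed
  obtain G' S' where G': "fds_instance (fds_word p q z) G'" and S': "S' \<in> feasible G'"
      "density G' S' \<ge> opt_density G' / (2 - \<epsilon>)"
      and y: "y = map (\<lambda>v. if v \<in> S' then 1 else 0) [0..<card (verts G')]"
    using ans by (auto simp: fds_answer_def fair_approximation_def)
  define \<theta> where "\<theta> = (2 - 1 / N) / (2 - \<epsilon>)"
  have "\<theta> * d / 4 = (2 - 1 / N) * d / 4 / (2 - \<epsilon>)" by (simp add: \<theta>_def)
  also have "\<dots> \<le> opt_density G' / (2 - \<epsilon>)"
    using opt_density_ge[OF G' t2 _ cS big] S(1) V \<epsilon> by (intro divide_right_mono) auto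
  finally have dens: "density G' S' \<ge> \<theta> * d / 4" using S'(2) by linarith
  have sel: "selected z y = S' \<inter> {..<n}"
  proof -
    have len: "length y = 2 * n" and nth: "y ! v = (if v \<in> S' then 1 else 0)" if "v < 2 * n" for v
      unfolding y fds_instance_decode(2)[OF G'] using that by simp_all
    have "v < n \<and> v < length y \<and> y ! v \<noteq> 0 \<longleftrightarrow> v \<in> S' \<and> v < n" for v
      using len[of v] nth[of v] by (cases "v < 2 * n") auto
    then show ?thesis unfolding selected_def z0 by blast
  qed
  have "1 + 2 / N < \<theta>"
  proof -
    \<comment> \<open>With \<open>\<eta> = 1 / N\<close> this expands to
      \<open>5 * \<eta> < \<epsilon> + 2 * \<eta> * \<epsilon>\<close>, whence the requirement
      \<open>5 / N < \<epsilon>\<close>.\<close>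
    have "(1 + 2 / N) * (2 - \<epsilon>) < 2 - 1 / N"
    proof -
      have "(1 + 2 / N) * (2 - \<epsilon>) = 2 + 4 / N - \<epsilon> - 2 / N * \<epsilon>" using N by (simp add: field_simps)
      moreover have "0 < \<epsilon>" by (rule le_less_trans[OF _ \<epsilon>(1)]) simp
      then have "0 \<le> 2 / N * \<epsilon>" by simp
      ultimately show ?thesis using \<epsilon>(1) by (simp add: field_simps)
    qed
    then show ?thesis using \<epsilon>(2) by (simp add: \<theta>_def field_simps)
  qed
  then have "(1 + 2 / N) * d * card (S' \<inter> {..<n}) < \<theta> * d * card (S' \<inter> {..<n})"
    using d_pos answer_ge(2)[OF G' t2 S'(1) dens] by simp
  also note answer_ge(1)[OF G' t2 S'(1) dens]
  finally show ?thesis using N t2 qS cS by (subst accepts_iff) (auto simp: sel)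
qed

section \<open>Execution with bounded values\<close>

fun esize :: "aexp \<Rightarrow> nat" where
  "esize (Num k) = 1"
| "esize (Arr a e) = 1 + esize e"
| "esize (Add e f) = 1 + esize e + esize f"
| "esize (Sub e f) = 1 + esize e + esize f"
| "esize (Mul e f) = 1 + esize e + esize f"
| "esize (Div e f) = 1 + esize e + esize f"

text \<open>\<open>Sub\<close> and \<open>Div\<close> carry no condition of their own, since their
  value never exceeds that of the first operand.\<close>

fun ebounded :: "nat \<Rightarrow> aexp \<Rightarrow> mem \<Rightarrow> bool" where
  "ebounded K (Num k) s \<longleftrightarrow> k \<le> K"
| "ebounded K (Arr a e) s \<longleftrightarrow> s a (eval e s) \<le> K \<and> ebounded K e s"
| "ebounded K (Add e f) s \<longleftrightarrow> eval e s + eval f s \<le> K \<and> ebounded K e s \<and> ebounded K f s"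
| "ebounded K (Sub e f) s \<longleftrightarrow> ebounded K e s \<and> ebounded K f s"
| "ebounded K (Mul e f) s \<longleftrightarrow> eval e s * eval f s \<le> K \<and> ebounded K e s \<and> ebounded K f s"
| "ebounded K (Div e f) s \<longleftrightarrow> ebounded K e s \<and> ebounded K f s"

lemma ebounded_eval: "ebounded K e s \<Longrightarrow> eval e s \<le> K"
proof (induction e)
  case (Div e f)
  then show ?case using order_trans[OF div_le_dividend[of "eval e s" "eval f s"], of K] by simp
qed auto

lemma bits_mono: "k \<le> l \<Longrightarrow> bits k \<le> bits l"
  by (rule floorlog_mono)

lemma cost_le:
  assumes "ebounded K e s"
  shows "cost e s \<le> esize e * (1 + bits K)"
proof -
  have b: "ebounded K e s \<Longrightarrow> bits (eval e s) \<le> bits K" for e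
    by (rule bits_mono[OF ebounded_eval])
  from assms show ?thesis
  proof (induction e)
    case (Num k)
    then show ?case using b[of "Num k"] by simp
  next
    case (Arr a e)
    then show ?case using b[of "Arr a e"] by simp
  next
    case (Add e f)
    then show ?case using b[of "Add e f"] by (simp add: add_mult_distrib)
  next
    case (Sub e f)
    then show ?case using b[of "Sub e f"] by (simp add: add_mult_distrib)
  next
    case (Mul e f)
    then show ?case using b[of "Mul e f"] by (simp add: add_mult_distrib)
  next
    case (Div e f)
    then show ?case using b[of "Div e f"] by (simp add: add_mult_distrib)
  qed
qed

fun csize :: "com \<Rightarrow> nat" where
  "csize Skip = 1"
| "csize (Store a i e) = 1 + esize i + esize e"
| "csize (Seq c c') = csize c + csize c'"
| "csize (Cond b c c') = 1 + esize b + csize c + csize c'"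
| "csize (Loop b c) = 1 + esize b + csize c"

text \<open>
  On loop-free commands the semantics is a function; the equations for \<open>Loop\<close> are dummies.
\<close>

fun step :: "com \<Rightarrow> mem \<Rightarrow> mem" where
  "step Skip s = s"
| "step (Store a i e) s = s(a := (s a)(eval i s := eval e s))"
| "step (Seq c c') s = step c' (step c s)"
| "step (Cond b c c') s = (if eval b s \<noteq> 0 then step c s else step c' s)"
| "step (Loop b c) s = s"

text \<open>The value on \<open>Loop\<close> confines the predicate to loop-free programs, for which
  \<open>step\<close> is the true semantics.\<close>

fun cbounded :: "nat \<Rightarrow> com \<Rightarrow> mem \<Rightarrow> bool" where
  "cbounded K Skip s \<longleftrightarrow> True"
| "cbounded K (Store a i e) s \<longleftrightarrow> ebounded K i s \<and> ebounded K e s"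
| "cbounded K (Seq c c') s \<longleftrightarrow> cbounded K c s \<and> cbounded K c' (step c s)"
| "cbounded K (Cond b c c') s \<longleftrightarrow>
     ebounded K b s \<and> (if eval b s \<noteq> 0 then cbounded K c s else cbounded K c' s)"
| "cbounded K (Loop b c) s \<longleftrightarrow> False"

lemma exec_step:
  "cbounded K c s \<Longrightarrow> \<exists>t. exec c s t (step c s) \<and> t \<le> csize c * (1 + bits K)"
proof (induction c arbitrary: s)
  case Skip
  show ?case using exec_Skip[of s] by (intro exI[of _ 1]) simp
next
  case (Store a i e)
  have "1 + cost i s + cost e s \<le> csize (Store a i e) * (1 + bits K)"
    using Store cost_le[of K i s] cost_le[of K e s] by (simp add: algebra_simps)
  moreover have "exec (Store a i e) s (1 + cost i s + cost e s) (step (Store a i e) s)"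
    using exec_Store[of a i e s] by simp
  ultimately show ?case by blast
next
  case (Seq c c')
  obtain t where "exec c s t (step c s)" "t \<le> csize c * (1 + bits K)"
    using Seq.IH(1)[of s] Seq.prems by auto
  moreover obtain t' where "exec c' (step c s) t' (step c' (step c s))" "t' \<le> csize c' * (1 + bits K)"
    using Seq.IH(2)[of "step c s"] Seq.prems by auto
  ultimately show ?case using exec_Seq[of c s t "step c s" c' t']
    by (intro exI[of _ "t + t'"]) (simp add: add_mult_distrib)
next
  case (Cond b c c')
  show ?case
  proof (cases "eval b s = 0")
    case True
    then obtain t where "exec c' s t (step c' s)" "t \<le> csize c' * (1 + bits K)"
      using Cond.IH(2)[of s] Cond.prems by auto
    then show ?thesis using True Cond.prems cost_le[of K b s]
        exec_Cond_False[of b s c' t "step c' s"]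
      by (intro exI[of _ "1 + cost b s + t"]) (simp add: add_mult_distrib)
  next
    case False
    then obtain t where "exec c s t (step c s)" "t \<le> csize c * (1 + bits K)"
      using Cond.IH(1)[of s] Cond.prems by auto
    then show ?thesis using False Cond.prems cost_le[of K b s]
        exec_Cond_True[of b s c t "step c s"]
      by (intro exI[of _ "1 + cost b s + t"]) (simp add: add_mult_distrib)
  qed
qed auto

text \<open>
  All values stay below \<open>K\<close> and all loops, none of them nested, run fewer than \<open>M\<close> times; this
  makes the time bound a function of the program text.
\<close>

definition reaches :: "nat \<Rightarrow> nat \<Rightarrow> com \<Rightarrow> mem \<Rightarrow> (mem \<Rightarrow> bool) \<Rightarrow> bool" where
  "reaches K M c s Q \<longleftrightarrow> (\<exists>t s'. exec c s t s' \<and> t \<le> csize c * (M * (1 + bits K)) \<and> Q s')"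

lemma reaches_step:
  assumes "cbounded K c s" "Q (step c s)" "1 \<le> M"
  shows "reaches K M c s Q"
proof -
  obtain t where t: "exec c s t (step c s)" "t \<le> csize c * (1 + bits K)" using exec_step[OF assms(1)] by auto
  have "csize c * (1 * (1 + bits K)) \<le> csize c * (M * (1 + bits K))"
    using assms(3) by (intro mult_le_mono) auto
  then have "t \<le> csize c * (M * (1 + bits K))" using t(2) by linarith
  then show ?thesis unfolding reaches_def using t(1) assms(2) by blast
qed

lemma reaches_Seq:
  assumes "reaches K M c s P" "\<And>s'. P s' \<Longrightarrow> reaches K M c' s' Q"
  shows "reaches K M (Seq c c') s Q"
proof -
  obtain t s' where 1: "exec c s t s'" "t \<le> csize c * (M * (1 + bits K))" "P s'"
    using assms(1) unfolding reaches_def by blast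
  obtain t' s'' where 2: "exec c' s' t' s''" "t' \<le> csize c' * (M * (1 + bits K))" "Q s''"
    using assms(2)[OF 1(3)] unfolding reaches_def by blast
  have "t + t' \<le> csize (Seq c c') * (M * (1 + bits K))"
    using 1(2) 2(2) by (simp only: csize.simps add_mult_distrib)
  then show ?thesis unfolding reaches_def using exec_Seq[OF 1(1) 2(1)] 2(3) by blast
qed

lemma reaches_weaken: "reaches K M c s P \<Longrightarrow> (\<And>s'. P s' \<Longrightarrow> Q s') \<Longrightarrow> reaches K M c s Q"
  unfolding reaches_def by blast

text \<open>The invariant is indexed by the number of completed rounds. The final failing test is
  charged like one more round, hence \<open>N < M\<close>.\<close>

lemma reaches_Loop:
  assumes step: "\<And>i s. i < N \<Longrightarrow> I i s \<Longrightarrow>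
      eval b s \<noteq> 0 \<and> ebounded K b s \<and> cbounded K c s \<and> I (Suc i) (step c s)"
    and fin: "\<And>s. I N s \<Longrightarrow> eval b s = 0 \<and> ebounded K b s"
    and init: "I 0 s" and NM: "N < M"
  shows "reaches K M (Loop b c) s (I N)"
proof -
  define W where "W = (1 + esize b + csize c) * (1 + bits K)"
  have "\<exists>t s'. exec (Loop b c) s t s' \<and> t \<le> (N - i + 1) * W \<and> I N s'" if "i \<le> N" "I i s" for i s
    using that
  proof (induction "N - i" arbitrary: i s)
    case 0
    then have "I N s" by simp
    moreover from fin[OF this] have "1 + cost b s \<le> (N - i + 1) * W" "exec (Loop b c) s (1 + cost b s) s"
      using cost_le[of K b s] "0.hyps" exec_Loop_False[of b s c] by (simp_all add: W_def add_mult_distrib)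
    ultimately show ?case by blast
  next
    case (Suc k)
    then have i: "i < N" by simp
    note st = step[OF i Suc.prems(2)]
    obtain t where t: "exec c s t (step c s)" "t \<le> csize c * (1 + bits K)"
      using exec_step[of K c s] st by auto
    have k: "k = N - Suc i" using Suc.hyps by simp
    have "Suc i \<le> N" "I (Suc i) (step c s)" using i st by auto
    from Suc.hyps(1)[OF k this]
    obtain t' s'' where t': "exec (Loop b c) (step c s) t' s''" "t' \<le> (N - Suc i + 1) * W" "I N s''"
      by blast
    have "exec (Loop b c) s (1 + cost b s + t + t') s''"
      using exec_Loop_True[OF _ t(1) t'(1)] st by blast
    moreover have "1 + cost b s + t \<le> W"
      using t(2) cost_le[of K b s] st by (simp add: W_def add_mult_distrib)
    moreover have "(N - i + 1) * W = (N - Suc i + 1) * W + W" using i by (simp add: algebra_simps Suc_diff_Suc)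
    ultimately have "exec (Loop b c) s (1 + cost b s + t + t') s''" "1 + cost b s + t + t' \<le> (N - i + 1) * W"
      using t'(2) by linarith+
    then show ?case using t'(3) by blast
  qed
  from this[of 0 s] init obtain t s' where *: "exec (Loop b c) s t s'" "t \<le> (N + 1) * W" "I N s'" by auto
  have "(N + 1) * W \<le> M * W" using NM by (intro mult_le_mono) auto
  then have "t \<le> csize (Loop b c) * (M * (1 + bits K))" using *(2) by (simp add: W_def algebra_simps)
  then show ?thesis unfolding reaches_def using * by blast
qed

section \<open>Programs do not depend on arrays they do not mention\<close>

fun efresh :: "nat \<Rightarrow> aexp \<Rightarrow> bool" where
  "efresh m (Num k) \<longleftrightarrow> True"
| "efresh m (Arr a e) \<longleftrightarrow> a < m \<and> efresh m e"
| "efresh m (Add e f) \<longleftrightarrow> efresh m e \<and> efresh m f"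
| "efresh m (Sub e f) \<longleftrightarrow> efresh m e \<and> efresh m f"
| "efresh m (Mul e f) \<longleftrightarrow> efresh m e \<and> efresh m f"
| "efresh m (Div e f) \<longleftrightarrow> efresh m e \<and> efresh m f"

fun cfresh :: "nat \<Rightarrow> com \<Rightarrow> bool" where
  "cfresh m Skip \<longleftrightarrow> True"
| "cfresh m (Store a i e) \<longleftrightarrow> a < m \<and> efresh m i \<and> efresh m e"
| "cfresh m (Seq c c') \<longleftrightarrow> cfresh m c \<and> cfresh m c'"
| "cfresh m (Cond b c c') \<longleftrightarrow> efresh m b \<and> cfresh m c \<and> cfresh m c'"
| "cfresh m (Loop b c) \<longleftrightarrow> efresh m b \<and> cfresh m c"

lemma efresh_mono: "efresh m e \<Longrightarrow> m \<le> m' \<Longrightarrow> efresh m' e"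
  by (induction e) auto

lemma cfresh_mono: "cfresh m c \<Longrightarrow> m \<le> m' \<Longrightarrow> cfresh m' c"
  by (induction c) (auto intro: efresh_mono)

lemma ex_efresh: "\<exists>m. efresh m e"
proof -
  have max: "\<exists>m. efresh m e \<and> efresh m f" if "efresh m e" "efresh m' f" for m m' e f
    using that by (intro exI[of _ "m + m'"]) (auto intro: efresh_mono)
  show ?thesis
  proof (induction e)
    case (Arr a e)
    then obtain m where "efresh m e" by auto
    then have "efresh (m + Suc a) (Arr a e)" by (auto intro: efresh_mono)
    then show ?case by blast
  qed (simp, (elim exE, simp, rule max, assumption+)+)
qed

lemma ex_cfresh: "\<exists>m. cfresh m c"
proof (induction c)
  case (Store a i e)
  obtain m m' where "efresh m i" "efresh m' e" using ex_efresh by blast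
  then have "cfresh (m + m' + Suc a) (Store a i e)" by (auto intro: efresh_mono)
  then show ?case by blast
next
  case (Seq c c')
  then obtain m m' where "cfresh m c" "cfresh m' c'" by blast
  then have "cfresh (m + m') (Seq c c')" by (auto intro: cfresh_mono)
  then show ?case by blast
next
  case (Cond b c c')
  then obtain m m' m'' where "efresh m b" "cfresh m' c" "cfresh m'' c'" using ex_efresh by blast
  then have "cfresh (m + m' + m'') (Cond b c c')" by (auto intro: efresh_mono cfresh_mono)
  then show ?case by blast
next
  case (Loop b c)
  then obtain m m' where "efresh m b" "cfresh m' c" using ex_efresh by blast
  then have "cfresh (m + m') (Loop b c)" by (auto intro: efresh_mono cfresh_mono)
  then show ?case by blast
qed auto

lemma eval_agree:
  "efresh m e \<Longrightarrow> (\<And>a. a < m \<Longrightarrow> r a = s a) \<Longrightarrow> eval e r = eval e s \<and> cost e r = cost e s"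
  by (induction e) auto

text \<open>About the program of an arbitrary reduction only its runs from \<open>load [x]\<close>
  are known. This transfers such a run, at the same cost, to a memory that keeps other data in the
  arrays from \<open>m\<close> on.\<close>

lemma exec_agree:
  "exec c s t s' \<Longrightarrow> cfresh m c \<Longrightarrow> \<forall>a<m. r a = s a \<Longrightarrow>
   \<exists>r'. exec c r t r' \<and> (\<forall>a<m. r' a = s' a) \<and> (\<forall>a\<ge>m. r' a = r a)"
proof (induction arbitrary: r rule: exec.induct)
  case (exec_Skip s)
  then show ?case using exec.exec_Skip[of r] by (intro exI[of _ r]) auto
next
  case (exec_Store a i e s)
  have "eval i r = eval i s \<and> cost i r = cost i s" "eval e r = eval e s \<and> cost e r = cost e s"
    by (rule eval_agree[of m]; use exec_Store.prems in simp)+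
  then have "exec (Store a i e) r (1 + cost i s + cost e s) (r(a := (r a)(eval i s := eval e s)))"
    using exec.exec_Store[of a i e r] by simp
  moreover have "\<forall>b<m. (r(a := (r a)(eval i s := eval e s))) b = (s(a := (s a)(eval i s := eval e s))) b"
    "\<forall>b\<ge>m. (r(a := (r a)(eval i s := eval e s))) b = r b"
    using exec_Store.prems by auto
  ultimately show ?case by blast
next
  case (exec_Seq c s t s' c' t' s'')
  obtain r' where r': "exec c r t r'" "\<forall>a<m. r' a = s' a" "\<forall>a\<ge>m. r' a = r a"
    using exec_Seq.IH(1)[of r] exec_Seq.prems by auto
  obtain r'' where "exec c' r' t' r''" "\<forall>a<m. r'' a = s'' a" "\<forall>a\<ge>m. r'' a = r' a"
    using exec_Seq.IH(2)[of r'] exec_Seq.prems r' by auto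
  then show ?case using r' exec.exec_Seq[of c r t r' c' t' r''] by (intro exI[of _ r'']) auto
next
  case (exec_Cond_True b s c t s' c')
  have "eval b r = eval b s \<and> cost b r = cost b s" by (rule eval_agree[of m]) (use exec_Cond_True.prems in simp_all)
  moreover obtain r' where "exec c r t r'" "\<forall>a<m. r' a = s' a" "\<forall>a\<ge>m. r' a = r a"
    using exec_Cond_True.IH[of r] exec_Cond_True.prems by auto
  ultimately show ?case using exec.exec_Cond_True[of b r] exec_Cond_True.hyps
    by (intro exI[of _ r']) auto
next
  case (exec_Cond_False b s c' t s' c)
  have "eval b r = eval b s \<and> cost b r = cost b s" by (rule eval_agree[of m]) (use exec_Cond_False.prems in simp_all)
  moreover obtain r' where "exec c' r t r'" "\<forall>a<m. r' a = s' a" "\<forall>a\<ge>m. r' a = r a"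
    using exec_Cond_False.IH[of r] exec_Cond_False.prems by auto
  ultimately show ?case using exec.exec_Cond_False[of b r] exec_Cond_False.hyps
    by (intro exI[of _ r']) auto
next
  case (exec_Loop_False b s c)
  have "eval b r = eval b s \<and> cost b r = cost b s" by (rule eval_agree[of m]) (use exec_Loop_False.prems in simp_all)
  then show ?case using exec_Loop_False.hyps exec_Loop_False.prems exec.exec_Loop_False[of b r c]
    by (intro exI[of _ r]) auto
next
  case (exec_Loop_True b s c t s' t' s'')
  have b: "eval b r = eval b s \<and> cost b r = cost b s" by (rule eval_agree[of m]) (use exec_Loop_True.prems in simp_all)
  obtain r' where r': "exec c r t r'" "\<forall>a<m. r' a = s' a" "\<forall>a\<ge>m. r' a = r a"
    using exec_Loop_True.IH(1)[of r] exec_Loop_True.prems by auto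
  obtain r'' where "exec (Loop b c) r' t' r''" "\<forall>a<m. r'' a = s'' a" "\<forall>a\<ge>m. r'' a = r' a"
    using exec_Loop_True.IH(2)[of r'] exec_Loop_True.prems r' by auto
  then show ?case using r' exec.exec_Loop_True[of b r c t r' t' r''] b exec_Loop_True.hyps
    by (intro exI[of _ r'']) auto
qed

section \<open>Programs for the reduction\<close>

text \<open>
  Entry \<open>j\<close> of a word sits in cell \<open>j + 1\<close> of array 0. Array 1 holds the scalars: cell 0 is the loop
  counter, cells 1 and 2 are a running fraction, 3 the clique size, 4 the number of vertices, 5 and 6
  temporaries, 7 and 8 the degree as a fraction, 9 the number of selected red vertices.
\<close>

abbreviation var :: "nat \<Rightarrow> aexp" where "var k \<equiv> Arr 1 (Num k)"
abbreviation assign :: "nat \<Rightarrow> aexp \<Rightarrow> com" where "assign k e \<equiv> Store 1 (Num k) e"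

text \<open>Conjunction by truncated subtraction: \<open>1 - e\<close> is 1 exactly if
  \<open>e\<close> is 0. The inner sum can reach 2, whence the condition on \<open>K\<close> in
  \<open>ebounded_both\<close>.\<close>

definition both :: "aexp \<Rightarrow> aexp \<Rightarrow> aexp" where
  "both e f = Sub (Num 1) (Add (Sub (Num 1) e) (Sub (Num 1) f))"

lemma eval_both: "eval (both e f) s = (if eval e s \<noteq> 0 \<and> eval f s \<noteq> 0 then 1 else 0)"
  by (auto simp: both_def)

lemma ebounded_both: "2 \<le> K \<Longrightarrow> ebounded K (both e f) s \<longleftrightarrow> ebounded K e s \<and> ebounded K f s"
  by (auto simp: both_def)

definition sum_init :: com where
  "sum_init = Seq (assign 0 (Num 0)) (Seq (assign 1 (Num 0)) (assign 2 (Num 1)))"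

text \<open>The numerator comes first because its update needs the old denominator. The addresses
  are shifted by one against \<open>wnum\<close> and \<open>wden\<close>, as cell 0 of array 0 holds
  the length.\<close>

definition sum_body :: "aexp \<Rightarrow> com" where
  "sum_body guard = Seq
     (Cond guard
       (Seq (assign 1 (Add (Mul (var 1) (Arr 0 (Add (Num 3) (Mul (Num 2) (var 0)))))
                           (Mul (var 2) (Arr 0 (Add (Num 2) (Mul (Num 2) (var 0)))))))
            (assign 2 (Mul (var 2) (Arr 0 (Add (Num 3) (Mul (Num 2) (var 0)))))))
       Skip)
     (assign 0 (Add (var 0) (Num 1)))"

definition sum_prog :: "aexp \<Rightarrow> aexp \<Rightarrow> com" where
  "sum_prog bnd guard = Seq sum_init (Loop (Sub bnd (var 0)) (sum_body guard))"

text \<open>The product in \<open>bd\<close> dominates every fraction value computed in a round,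
  including the two products that form the new numerator. The final memory is given exactly, so that
  facts about all other cells survive.\<close>

lemma reaches_sum_prog:
  fixes s :: mem and L :: nat and a b :: "nat \<Rightarrow> nat" and P :: "nat \<Rightarrow> bool"
  defines "S \<equiv> \<lambda>i. s(1 := (s 1)(0 := i, 1 := frac_num a b P i, 2 := frac_den b P i))"
  assumes bnd: "\<And>i. i \<le> L \<Longrightarrow> eval bnd (S i) = L \<and> ebounded K bnd (S i)"
    and guard: "\<And>i. i < L \<Longrightarrow> (eval guard (S i) \<noteq> 0 \<longleftrightarrow> P i) \<and> ebounded K guard (S i)"
    and mem: "\<And>i. i < L \<Longrightarrow> s 0 (2 + 2 * i) = a i \<and> s 0 (3 + 2 * i) = b i \<and> b i \<noteq> 0"
    and bd: "\<And>i. i < L \<Longrightarrow> (frac_num a b P i + frac_den b P i) * (a i + b i) \<le> K"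
    and L: "2 * L + 3 \<le> K" "L < M"
  shows "reaches K M (sum_prog bnd guard) s (\<lambda>s'. s' = S L)"
  unfolding sum_prog_def
proof (rule reaches_Seq[where P = "\<lambda>s'. s' = S 0"])
  show "reaches K M sum_init s (\<lambda>s'. s' = S 0)"
    by (rule reaches_step) (use L in \<open>auto simp: sum_init_def S_def\<close>)
next
  fix s' assume s': "s' = S 0"
  show "reaches K M (Loop (Sub bnd (var 0)) (sum_body guard)) s' (\<lambda>s'. s' = S L)"
  proof (rule reaches_Loop[where I = "\<lambda>i s'. s' = S i"])
    fix i r assume i: "i < L" and r: "r = S i"
    have "0 < frac_den b P i" using mem i by (intro frac_den_pos) auto
    then have b1: "frac_num a b P i * 1 \<le> (frac_num a b P i + frac_den b P i) * (a i + b i)"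
      "frac_den b P i * 1 \<le> (frac_num a b P i + frac_den b P i) * (a i + b i)"
      "1 * a i \<le> (frac_num a b P i + frac_den b P i) * (a i + b i)"
      "1 * b i \<le> (frac_num a b P i + frac_den b P i) * (a i + b i)"
      using mem[OF i] by (intro mult_le_mono; simp)+
    have b2:
      "frac_num a b P i * b i + frac_den b P i * a i \<le> (frac_num a b P i + frac_den b P i) * (a i + b i)"
      "frac_den b P i * b i \<le> (frac_num a b P i + frac_den b P i) * (a i + b i)"
      "frac_den b P i * a i \<le> (frac_num a b P i + frac_den b P i) * (a i + b i)"
      "frac_num a b P i * b i \<le> (frac_num a b P i + frac_den b P i) * (a i + b i)"
      by (simp_all add: algebra_simps)
    note bds = b1[THEN order_trans[OF _ bd[OF i]]] b2[THEN order_trans[OF _ bd[OF i]]]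
    have "ebounded K (Sub bnd (var 0)) r" "eval (Sub bnd (var 0)) r \<noteq> 0"
      using bnd[of i] i L unfolding r by (auto simp: S_def)
    moreover have "cbounded K (sum_body guard) r"
      using guard[OF i] mem[OF i] bds i L unfolding r sum_body_def by (simp add: S_def)
    moreover have "step (sum_body guard) r = S (Suc i)"
      using guard[OF i] mem[OF i] unfolding r sum_body_def
      by (auto simp: S_def fun_eq_iff)
    ultimately show "eval (Sub bnd (var 0)) r \<noteq> 0 \<and> ebounded K (Sub bnd (var 0)) r \<and>
      cbounded K (sum_body guard) r \<and> step (sum_body guard) r = S (Suc i)" by blast
  next
    fix r assume r: "r = S L"
    show "eval (Sub bnd (var 0)) r = 0 \<and> ebounded K (Sub bnd (var 0)) r"
      using bnd[of L] L unfolding r by (simp add: S_def)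
  qed (use L s' in auto)
qed

section \<open>Bit lengths of entries and of exact sums\<close>

lemma wsize_eq_sum: "wsize z = (\<Sum>j<length z. bits (z ! j) + 1)"
  by (simp add: wsize_def sum_list_sum_nth atLeast0LessThan)

lemma length_le_wsize: "length z \<le> wsize z"
proof -
  have "(\<Sum>j<length z. 1) \<le> wsize z" unfolding wsize_eq_sum by (rule sum_mono) simp
  then show ?thesis by simp
qed

lemma less_two_power_bits: "k < 2 ^ bits k"
  by (rule floorlog_leD) auto

text \<open>The delimiter counted in \<open>wsize\<close> pays for the factor 2, so even the sum of
  two entries stays below \<open>2 ^ wsize z\<close>.\<close>

lemma nth_less_wsize:
  assumes "j < length z" shows "2 * z ! j < 2 ^ wsize z"
proof -
  have "(\<Sum>j\<in>{j}. bits (z ! j) + 1) \<le> wsize z" unfolding wsize_eq_sum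
    by (rule sum_mono2) (use assms in auto)
  then have "bits (z ! j) + 1 \<le> wsize z" by simp
  then have "(2::nat) ^ (bits (z ! j) + 1) \<le> 2 ^ wsize z" by (intro power_increasing) auto
  then show ?thesis using less_two_power_bits[of "z ! j"] by (simp del: Suc_eq_plus1)
qed

lemma sum_pairs_le: "(\<Sum>i<m. g (1 + 2 * i) + g (2 + 2 * i)) \<le> (\<Sum>j<1 + 2 * m. g j :: nat)" for m :: nat
  by (induction m) auto

text \<open>By \<open>frac_le_prod\<close> a product over the entries is an upper bound; the bit
  lengths of its factors add up to a part of \<open>wsize z\<close>. This is why exact sums of up to
  \<open>n * n\<close> fractions remain short.\<close>

lemma frac_le_wsize:
  assumes z: "graph_word z n" and k: "k \<le> n * n"
  shows "frac_num (wnum z) (wden z) P k + frac_den (wden z) P k \<le> 2 ^ wsize z"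
proof -
  have len: "length z = 1 + 2 * (n * n)" using z by (simp add: graph_word_def power2_eq_square)
  have "frac_num (wnum z) (wden z) P k + frac_den (wden z) P k \<le> (\<Prod>i<k. wnum z i + wden z i)"
    using z k by (intro frac_le_prod) (auto simp: graph_word_def)
  also have "\<dots> \<le> (\<Prod>i<k. 2 ^ ((bits (wnum z i) + 1) + (bits (wden z i) + 1)))"
  proof (rule prod_mono, safe)
    fix i
    have "wnum z i < 2 ^ (bits (wnum z i) + bits (wden z i))"
      using less_two_power_bits[of "wnum z i"] by (rule order_less_le_trans) (simp add: power_add)
    moreover have "wden z i < 2 ^ (bits (wnum z i) + bits (wden z i))"
      using less_two_power_bits[of "wden z i"] by (rule order_less_le_trans) (simp add: power_add)
    ultimately have "wnum z i + wden z i \<le> 2 * 2 ^ (bits (wnum z i) + bits (wden z i))" by linarith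
    also have "\<dots> \<le> 2 ^ ((bits (wnum z i) + 1) + (bits (wden z i) + 1))" by simp
    finally show "wnum z i + wden z i \<le> 2 ^ ((bits (wnum z i) + 1) + (bits (wden z i) + 1))" .
  qed
  also have "\<dots> = 2 ^ (\<Sum>i<k. (bits (wnum z i) + 1) + (bits (wden z i) + 1))" by (simp add: power_sum)
  also have "\<dots> \<le> 2 ^ wsize z"
  proof (rule power_increasing)
    have "(\<Sum>i<k. (bits (wnum z i) + 1) + (bits (wden z i) + 1)) \<le>
      (\<Sum>i<n * n. (bits (wnum z i) + 1) + (bits (wden z i) + 1))"
      using k by (intro sum_mono2) auto
    also have "\<dots> \<le> wsize z" unfolding wsize_eq_sum len by (rule sum_pairs_le)
    finally show "(\<Sum>i<k. (bits (wnum z i) + 1) + (bits (wden z i) + 1)) \<le> wsize z" .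
  qed simp
  finally show ?thesis .
qed

lemma frac_step_le_wsize:
  assumes z: "graph_word z n" and k: "k < n * n"
  shows "(frac_num (wnum z) (wden z) P k + frac_den (wden z) P k) * (wnum z k + wden z k) \<le> 2 ^ (2 * wsize z)"
proof -
  have len: "length z = 1 + 2 * (n * n)" using z by (simp add: graph_word_def power2_eq_square)
  have "2 * wnum z k < 2 ^ wsize z" "2 * wden z k < 2 ^ wsize z"
    using k len by (intro nth_less_wsize; simp)+
  then have "wnum z k + wden z k \<le> 2 ^ wsize z" by linarith
  then have "(frac_num (wnum z) (wden z) P k + frac_den (wden z) P k) * (wnum z k + wden z k) \<le> 2 ^ wsize z * 2 ^ wsize z"
    using frac_le_wsize[OF z less_imp_le[OF k]] by (intro mult_le_mono) auto
  then show ?thesis by (simp add: mult_2 power_add)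
qed

section \<open>The program that writes the constructed graph\<close>

definition setup_prog :: "nat \<Rightarrow> nat \<Rightarrow> com" where
  "setup_prog p q = Seq (assign 4 (Arr 0 (Num 1)))
     (Seq (assign 3 (Div (Mul (Num p) (var 4)) (Num q))) (assign 0 (Num 0)))"

text \<open>The output is going to overwrite array 0, so the input is first saved in array
  2.\<close>

definition copy_body :: com where
  "copy_body = Seq (Store 2 (var 0) (Arr 0 (var 0))) (assign 0 (Add (var 0) (Num 1)))"

definition emit :: "aexp \<Rightarrow> aexp \<Rightarrow> com" where
  "emit e f = Seq (Store 0 (Add (Num 2) (Mul (Num 2) (var 0))) e)
                  (Store 0 (Add (Num 3) (Mul (Num 2) (var 0))) f)"

text \<open>Cells 1 and 2 still hold the degree left there by \<open>sum_prog\<close>. The column is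
  the remainder of the counter modulo \<open>2 * n\<close>, obtained by subtracting a
  multiple.\<close>

definition build_body :: com where
  "build_body =
     Seq (assign 5 (Div (var 0) (Mul (Num 2) (var 4))))
    (Seq (assign 6 (Sub (var 0) (Mul (var 5) (Mul (Num 2) (var 4)))))
    (Seq (Cond (both (Sub (var 4) (var 5)) (Sub (var 4) (var 6)))
           (emit (Arr 2 (Add (Num 2) (Mul (Num 2) (Add (Mul (var 4) (var 5)) (var 6)))))
                 (Arr 2 (Add (Num 3) (Mul (Num 2) (Add (Mul (var 4) (var 5)) (var 6))))))
         (Cond (both (both (Sub (Add (var 5) (Add (var 3) (Num 1))) (Mul (Num 2) (var 4)))
                           (Sub (Add (var 6) (Add (var 3) (Num 1))) (Mul (Num 2) (var 4))))
                     (Add (Sub (var 5) (var 6)) (Sub (var 6) (var 5))))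
           (emit (var 1) (Mul (var 2) (Sub (var 3) (Num 1))))
           (emit (Num 0) (Num 1))))
     (assign 0 (Add (var 0) (Num 1)))))"

text \<open>Truncated \<open>1 - (1 - x)\<close> turns every nonzero \<open>x\<close> into 1; with
  \<open>x = n - i\<close> it is the indicator of the red vertices.\<close>

definition colour_body :: com where
  "colour_body = Seq
     (Store 0 (Add (Num 2) (Add (Mul (Num 8) (Mul (var 4) (var 4))) (var 0)))
        (Sub (Num 1) (Sub (Num 1) (Sub (var 4) (var 0)))))
     (assign 0 (Add (var 0) (Num 1)))"

definition finish_prog :: com where
  "finish_prog = Seq (Store 0 (Num 1) (Mul (Num 2) (var 4)))
     (Store 0 (Num 0) (Add (Num 1) (Add (Mul (Num 8) (Mul (var 4) (var 4))) (Mul (Num 2) (var 4)))))"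

definition reduction_prog :: "nat \<Rightarrow> nat \<Rightarrow> com" where
  "reduction_prog p q =
     Seq (sum_prog (Arr 0 (Num 1)) (Num 1))
    (Seq (setup_prog p q)
    (Seq (Loop (Sub (Add (Arr 0 (Num 0)) (Num 1)) (var 0)) copy_body)
    (Seq (assign 0 (Num 0))
    (Seq (Loop (Sub (Mul (Num 4) (Mul (var 4) (var 4))) (var 0)) build_body)
    (Seq (assign 0 (Num 0))
    (Seq (Loop (Sub (Mul (Num 2) (var 4)) (var 0)) colour_body)
         finish_prog))))))"

definition holds_word :: "mem \<Rightarrow> word \<Rightarrow> bool" where
  "holds_word s z \<longleftrightarrow> s 0 0 = length z \<and> (\<forall>i<length z. s 0 (Suc i) = z ! i)"

lemma out_word_holds: "holds_word s (out_word s)"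
  by (simp add: holds_word_def out_word_def)

lemma holds_out_word: "holds_word s z \<Longrightarrow> out_word s = z"
  by (rule nth_equalityI) (auto simp: holds_word_def out_word_def)

section \<open>Correctness of that program with all values below a bound\<close>

locale bounded_word =
  fixes z :: word and n p q K M :: nat
  assumes gw: "graph_word z n" and n_pos: "0 < n" and t_le: "clique_size p q z \<le> n"
    and K_big: "2 ^ (2 * wsize z) \<le> K" and K_idx: "8 * (n * n) + 2 * n + 20 \<le> K"
    and K_pq: "p * n \<le> K" "p \<le> K" "q \<le> K" and M_big: "4 * (n * n) + 2 * n + 2 < M"
begin

lemma z0: "z ! 0 = n" and len: "length z = 1 + 2 * (n * n)"
  using gw by (simp_all add: graph_word_def power2_eq_square)

lemma n_le: "n \<le> n * n" using n_pos by simp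

lemma entry_le: "j < length z \<Longrightarrow> z ! j \<le> K"
proof -
  assume "j < length z"
  then have "z ! j \<le> 2 ^ wsize z" using nth_less_wsize[of j z] by linarith
  also have "\<dots> \<le> 2 ^ (2 * wsize z)" by (rule power_increasing) auto
  finally show "z ! j \<le> K" using K_big by linarith
qed

lemma deg_le: "deg_num z \<le> 2 ^ wsize z" "deg_den z \<le> 2 ^ wsize z"
  using frac_le_wsize[OF gw, of n "\<lambda>_. True"] n_le by (simp_all add: deg_num_def deg_den_def z0)

lemma deg_le_K: "deg_num z \<le> K" "deg_den z \<le> K" "deg_den z * (clique_size p q z - 1) \<le> K"
proof -
  have 1: "(2::nat) ^ wsize z \<le> 2 ^ (2 * wsize z)" by (rule power_increasing) auto
  show "deg_num z \<le> K" "deg_den z \<le> K" using deg_le 1 K_big by linarith+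
  have "clique_size p q z - 1 \<le> z ! 0" using t_le z0 by simp
  also have "\<dots> \<le> 2 ^ wsize z" using nth_less_wsize[of 0 z] len by simp
  finally have "deg_den z * (clique_size p q z - 1) \<le> 2 ^ wsize z * 2 ^ wsize z" using deg_le(2) by (rule mult_le_mono[rotated])
  then show "deg_den z * (clique_size p q z - 1) \<le> K" using K_big by (simp add: mult_2 power_add)
qed

lemma holds_pair:
  assumes "holds_word s z" "i < n * n"
  shows "s 0 (2 + 2 * i) = wnum z i" "s 0 (3 + 2 * i) = wden z i"
proof -
  have "s 0 (Suc (1 + 2 * i)) = wnum z i" "s 0 (Suc (2 + 2 * i)) = wden z i"
    using assms len unfolding holds_word_def by auto
  then show "s 0 (2 + 2 * i) = wnum z i" "s 0 (3 + 2 * i) = wden z i"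
    by (simp_all add: numeral_2_eq_2 numeral_3_eq_3)
qed

lemma reaches_degree:
  assumes "holds_word s z"
  shows "reaches K M (sum_prog (Arr 0 (Num 1)) (Num 1)) s
    (\<lambda>s'. s' = s(1 := (s 1)(0 := n, 1 := deg_num z, 2 := deg_den z)))"
proof -
  have s1: "s 0 (Suc 0) = n" using assms len by (simp add: holds_word_def z0)
  show ?thesis unfolding deg_num_def deg_den_def z0
  proof (rule reaches_sum_prog)
    fix i assume i: "i < n"
    then have i2: "i < n * n" using n_le by linarith
    show "s 0 (2 + 2 * i) = wnum z i \<and> s 0 (3 + 2 * i) = wden z i \<and> wden z i \<noteq> 0"
      using holds_pair[OF assms i2] gw i2 by (simp add: graph_word_def)
    show "(frac_num (wnum z) (wden z) (\<lambda>_. True) i + frac_den (wden z) (\<lambda>_. True) i) * (wnum z i + wden z i) \<le> K"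
      using frac_step_le_wsize[OF gw i2] K_big by (rule order_trans)
  qed (use s1 K_idx M_big n_le in auto)
qed

definition ready :: "mem \<Rightarrow> bool" where
  "ready s \<longleftrightarrow> s 1 1 = deg_num z \<and> s 1 2 = deg_den z \<and> s 1 3 = clique_size p q z \<and> s 1 4 = n"

definition copied :: "mem \<Rightarrow> bool" where
  "copied s \<longleftrightarrow> (\<forall>i<n * n. s 2 (2 + 2 * i) = wnum z i \<and> s 2 (3 + 2 * i) = wden z i)"

lemma reaches_copy:
  assumes "holds_word s z" "ready s" "s 1 0 = 0"
  shows "reaches K M (Loop (Sub (Add (Arr 0 (Num 0)) (Num 1)) (var 0)) copy_body) s
    (\<lambda>s'. ready s' \<and> copied s')"
proof (rule reaches_weaken)
  \<comment> \<open>One round more than there are entries, because copying starts at the cell that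
    holds the length.\<close>
  define N where "N = length z + 1"
  define I where "I i s' \<longleftrightarrow> ready s' \<and> s' 0 = s 0 \<and> s' 1 0 = i \<and> (\<forall>j<i. s' 2 j = s 0 j)" for i s'
  have N: "N + 20 \<le> K" "N < M" unfolding N_def len using K_idx M_big n_pos by linarith+
  have s0: "s 0 0 = length z" using assms by (simp add: holds_word_def)
  have sK: "s 0 j \<le> K" if "j < N" for j
  proof (cases j)
    case (Suc i)
    then show ?thesis using assms(1) that entry_le[of i] by (simp add: holds_word_def N_def)
  qed (use s0 N in \<open>simp add: N_def\<close>)
  show "reaches K M (Loop (Sub (Add (Arr 0 (Num 0)) (Num 1)) (var 0)) copy_body) s (I N)"
  proof (rule reaches_Loop)
    fix i r assume i: "i < N" and r: "I i r"
    show "eval (Sub (Add (Arr 0 (Num 0)) (Num 1)) (var 0)) r \<noteq> 0 \<and>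
      ebounded K (Sub (Add (Arr 0 (Num 0)) (Num 1)) (var 0)) r \<and>
      cbounded K copy_body r \<and> I (Suc i) (step copy_body r)"
      using i r N s0 sK[OF i] by (auto simp: I_def copy_body_def ready_def N_def less_Suc_eq)
  next
    fix r assume r: "I N r"
    show "eval (Sub (Add (Arr 0 (Num 0)) (Num 1)) (var 0)) r = 0 \<and>
      ebounded K (Sub (Add (Arr 0 (Num 0)) (Num 1)) (var 0)) r"
      using r N s0 by (auto simp: I_def N_def)
  qed (use assms N in \<open>auto simp: I_def\<close>)
  fix s' assume "I N s'"
  then have "ready s'" "s' 2 j = s 0 j" if "j < N" for j using that by (auto simp: I_def N_def)
  then show "ready s' \<and> copied s'"
    using holds_pair[OF assms(1)] len by (auto simp: copied_def N_def)
qed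

lemma build_step:
  assumes s: "ready s" "copied s" "s 1 0 = i" and i: "i < 4 * (n * n)"
  shows "cbounded K build_body s" "ready (step build_body s)" "copied (step build_body s)"
    "step build_body s 1 0 = Suc i"
    "step build_body s 0 = (s 0)(2 + 2 * i := out_num p q z (i div (2 * n)) (i mod (2 * n)),
                                 3 + 2 * i := out_den p q z (i div (2 * n)) (i mod (2 * n)))"
proof -
  define u where "u = i div (2 * n)"
  define v where "v = i mod (2 * n)"
  define T where "T = clique_size p q z"
  have v: "v < 2 * n" using n_pos by (simp add: v_def)
  have "i < 2 * n * (2 * n)" using i by simp
  then have u: "u < 2 * n" unfolding u_def by (rule less_mult_imp_div_less)
  have iv: "i - u * (2 * n) = v" "u * (2 * n) \<le> i"
    unfolding u_def v_def by (simp_all add: minus_div_mult_eq_mod)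
  have s': "s (Suc 0) (Suc 0) = deg_num z" "s (Suc 0) 2 = deg_den z" "s (Suc 0) 3 = T" "s (Suc 0) 4 = n" "s (Suc 0) 0 = i"
    using s by (auto simp: ready_def T_def)
  have T: "T \<le> n" using t_le by (simp add: T_def)
  have b: "deg_num z \<le> K" "deg_den z \<le> K" "deg_den z * (T - Suc 0) \<le> K" using deg_le_K by (simp_all add: T_def)
  have small: "i + i + 3 \<le> K" "2 * n + 2 * n + 20 \<le> K" using i K_idx n_le by linarith+
  define pre where "pre = s(1 := (s 1)(5 := u, 6 := v))"
  define g1 where "g1 = both (Sub (var 4) (var 5)) (Sub (var 4) (var 6))"
  define g2 where "g2 = both (both (Sub (Add (var 5) (Add (var 3) (Num 1))) (Mul (Num 2) (var 4)))
                           (Sub (Add (var 6) (Add (var 3) (Num 1))) (Mul (Num 2) (var 4))))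
                     (Add (Sub (var 5) (var 6)) (Sub (var 6) (var 5)))"
  define e1 where "e1 = emit (Arr 2 (Add (Num 2) (Mul (Num 2) (Add (Mul (var 4) (var 5)) (var 6)))))
                 (Arr 2 (Add (Num 3) (Mul (Num 2) (Add (Mul (var 4) (var 5)) (var 6)))))"
  define e2 where "e2 = emit (var 1) (Mul (var 2) (Sub (var 3) (Num 1)))"
  define e3 where "e3 = emit (Num 0) (Num 1)"
  define mid where "mid = Cond g1 e1 (Cond g2 e2 e3)"
  have p: "pre (Suc 0) (Suc 0) = deg_num z" "pre (Suc 0) 2 = deg_den z" "pre (Suc 0) 3 = T"
    "pre (Suc 0) 4 = n" "pre (Suc 0) 0 = i" "pre (Suc 0) 5 = u" "pre (Suc 0) 6 = v"
    using s' by (simp_all add: pre_def)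
  have g1: "eval g1 pre \<noteq> 0 \<longleftrightarrow> u < n \<and> v < n" "ebounded K g1 pre"
    using p u v small by (auto simp: g1_def eval_both ebounded_both)
  have g2: "eval g2 pre \<noteq> 0 \<longleftrightarrow> 2 * n < u + T + 1 \<and> 2 * n < v + T + 1 \<and> u \<noteq> v"
    unfolding g2_def using p by (simp add: eval_both less_diff_conv) linarith
  have g2b: "ebounded K g2 pre"
    unfolding g2_def using p u v T small by (simp add: ebounded_both)
  have mid: "cbounded K mid pre \<and> step mid pre = pre(0 := (pre 0)(2 + 2 * i := out_num p q z u v, 3 + 2 * i := out_den p q z u v))"
  proof (cases "u < n \<and> v < n")
    case True
    have idx: "n * u + v < n * n" using index_less True by blast
    then have c: "pre 2 (2 + 2 * (n * u + v)) = wnum z (n * u + v)" "pre 2 (3 + 2 * (n * u + v)) = wden z (n * u + v)"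
      using s(2) by (auto simp: copied_def pre_def)
    have e: "wnum z (n * u + v) \<le> K" "wden z (n * u + v) \<le> K" using idx len by (intro entry_le; simp)+
    have "2 * w + 3 \<le> K" if "w < n * n" for w using that K_idx by simp
    from this[OF idx] have nu: "2 * (n * u + v) + 3 \<le> K" .
    have "cbounded K e1 pre" unfolding e1_def emit_def using p c e nu small u v by simp
    moreover have "step e1 pre = pre(0 := (pre 0)(2 + 2 * i := out_num p q z u v, 3 + 2 * i := out_den p q z u v))"
      unfolding e1_def emit_def using p c True by (simp add: out_num_def out_den_def z0)
    moreover have "eval g1 pre \<noteq> 0" using g1(1) True by blast
    ultimately show ?thesis using g1(2) by (simp add: mid_def)
  next
    case False
    then have ev: "eval g1 pre = 0" using g1(1) by blast
    show ?thesis
    proof (cases "2 * n < u + T + 1 \<and> 2 * n < v + T + 1 \<and> u \<noteq> v")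
      case True
      have "cbounded K e2 pre" unfolding e2_def emit_def using p b small T by simp
      moreover have "out_num p q z u v = deg_num z" "out_den p q z u v = deg_den z * (T - 1)"
        using True False unfolding out_num_def out_den_def z0 T_def[symmetric] by (simp_all only: if_True if_False simp_thms)
      then have "step e2 pre = pre(0 := (pre 0)(2 + 2 * i := out_num p q z u v, 3 + 2 * i := out_den p q z u v))"
        unfolding e2_def emit_def using p by simp
      moreover have "eval g2 pre \<noteq> 0" using g2 True by blast
      ultimately show ?thesis using ev g1(2) g2b by (simp add: mid_def)
    next
      case c: False
      have "cbounded K e3 pre" unfolding e3_def emit_def using p small by simp
      moreover have "out_num p q z u v = 0" "out_den p q z u v = 1"
        using c False unfolding out_num_def out_den_def z0 T_def[symmetric] by (simp_all only: if_False)
      then have "step e3 pre = pre(0 := (pre 0)(2 + 2 * i := out_num p q z u v, 3 + 2 * i := out_den p q z u v))"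
        unfolding e3_def emit_def using p by simp
      moreover have "eval g2 pre = 0" using g2 c by blast
      ultimately show ?thesis using ev g1(2) g2b by (simp add: mid_def)
    qed
  qed
  have s5: "step (assign 5 (Div (var 0) (Mul (Num 2) (var 4)))) s = s(1 := (s 1)(5 := u))"
    using s' by (simp add: u_def)
  have s6: "step (assign 6 (Sub (var 0) (Mul (var 5) (Mul (Num 2) (var 4))))) (s(1 := (s 1)(5 := u))) = pre"
    using s' iv by (simp add: pre_def)
  have body: "build_body = Seq (assign 5 (Div (var 0) (Mul (Num 2) (var 4))))
    (Seq (assign 6 (Sub (var 0) (Mul (var 5) (Mul (Num 2) (var 4)))))
    (Seq mid (assign 0 (Add (var 0) (Num 1)))))" by (simp add: build_body_def mid_def g1_def g2_def e1_def e2_def e3_def)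
  have bs: "step build_body s = step (assign 0 (Add (var 0) (Num 1))) (step mid pre)"
    and bb: "cbounded K build_body s \<longleftrightarrow> cbounded K (assign 5 (Div (var 0) (Mul (Num 2) (var 4)))) s \<and>
      cbounded K (assign 6 (Sub (var 0) (Mul (var 5) (Mul (Num 2) (var 4))))) (s(1 := (s 1)(5 := u))) \<and>
      cbounded K mid pre \<and> cbounded K (assign 0 (Add (var 0) (Num 1))) (step mid pre)"
    unfolding body step.simps(3) cbounded.simps(3) s5 s6 by (rule refl)+
  show "cbounded K build_body s"
    unfolding bb using mid p s' small iv i u K_idx by simp
  show "ready (step build_body s)" "copied (step build_body s)" "step build_body s 1 0 = Suc i"
    "step build_body s 0 = (s 0)(2 + 2 * i := out_num p q z (i div (2 * n)) (i mod (2 * n)),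
                                 3 + 2 * i := out_den p q z (i div (2 * n)) (i mod (2 * n)))"
    unfolding bs using mid p s(2) by (auto simp: ready_def copied_def T_def pre_def u_def v_def)
qed

lemma reaches_build:
  assumes "ready s" "copied s" "s 1 0 = 0"
  shows "reaches K M (Loop (Sub (Mul (Num 4) (Mul (var 4) (var 4))) (var 0)) build_body) s
    (\<lambda>s'. s' 1 4 = n \<and> (\<forall>j<4 * (n * n). s' 0 (2 + 2 * j) = out_num p q z (j div (2 * n)) (j mod (2 * n)) \<and>
       s' 0 (3 + 2 * j) = out_den p q z (j div (2 * n)) (j mod (2 * n))))"
proof (rule reaches_weaken)
  define N where "N = 4 * (n * n)"
  define I where "I i s' \<longleftrightarrow> ready s' \<and> copied s' \<and> s' 1 0 = i \<and>
    (\<forall>j<i. s' 0 (2 + 2 * j) = out_num p q z (j div (2 * n)) (j mod (2 * n)) \<and>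
       s' 0 (3 + 2 * j) = out_den p q z (j div (2 * n)) (j mod (2 * n)))" for i s'
  have b: "eval (Sub (Mul (Num 4) (Mul (var 4) (var 4))) (var 0)) r = N - i"
    "ebounded K (Sub (Mul (Num 4) (Mul (var 4) (var 4))) (var 0)) r" if "I i r" "i \<le> N" for i r
  proof -
    have r: "r (Suc 0) 4 = n" "r (Suc 0) 0 = i" using that by (auto simp: I_def ready_def)
    then show "eval (Sub (Mul (Num 4) (Mul (var 4) (var 4))) (var 0)) r = N - i" by (simp add: N_def)
    have "n \<le> K" using K_idx by simp
    then show "ebounded K (Sub (Mul (Num 4) (Mul (var 4) (var 4))) (var 0)) r"
      using r that(2) K_idx by (simp add: N_def)
  qed
  show "reaches K M (Loop (Sub (Mul (Num 4) (Mul (var 4) (var 4))) (var 0)) build_body) s (I N)"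
  proof (rule reaches_Loop)
    fix i r assume i: "i < N" and r: "I i r"
    have r': "ready r" "copied r" "r 1 0 = i" using r by (auto simp: I_def)
    note st = build_step[OF r' i[unfolded N_def]]
    have "I (Suc i) (step build_body r)"
      unfolding I_def
    proof (intro conjI allI impI)
      fix j assume j: "j < Suc i"
      \<comment> \<open>Parity keeps the cells of numerators and denominators apart, so a round
        leaves earlier entries intact.\<close>
      have ne: "2 + 2 * j \<noteq> 3 + 2 * i" "3 + 2 * j \<noteq> 2 + 2 * i" by presburger+
      show "step build_body r 0 (2 + 2 * j) = out_num p q z (j div (2 * n)) (j mod (2 * n))"
        "step build_body r 0 (3 + 2 * j) = out_den p q z (j div (2 * n)) (j mod (2 * n))"
        unfolding st(5) fun_upd_apply if_not_P[OF ne(1)] if_not_P[OF ne(2)]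
        using r j unfolding I_def less_Suc_eq by auto
    qed (use st in auto)
    then show "eval (Sub (Mul (Num 4) (Mul (var 4) (var 4))) (var 0)) r \<noteq> 0 \<and>
      ebounded K (Sub (Mul (Num 4) (Mul (var 4) (var 4))) (var 0)) r \<and>
      cbounded K build_body r \<and> I (Suc i) (step build_body r)"
      using b[OF r] i st(1) by (simp only:) simp
  next
    fix r assume r: "I N r"
    show "eval (Sub (Mul (Num 4) (Mul (var 4) (var 4))) (var 0)) r = 0 \<and>
      ebounded K (Sub (Mul (Num 4) (Mul (var 4) (var 4))) (var 0)) r"
      using b[OF r] by (simp only: order_refl) simp
  next
    show "N < M" using M_big by (simp add: N_def)
  qed (use assms in \<open>simp add: I_def\<close>)
  fix s' assume "I N s'"
  then show "s' 1 4 = n \<and> (\<forall>j<4 * (n * n). s' 0 (2 + 2 * j) = out_num p q z (j div (2 * n)) (j mod (2 * n)) \<and>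
       s' 0 (3 + 2 * j) = out_den p q z (j div (2 * n)) (j mod (2 * n)))"
    by (simp add: I_def N_def ready_def)
qed

lemma reaches_colour:
  assumes "s 1 4 = n" "s 1 0 = 0"
  shows "reaches K M (Loop (Sub (Mul (Num 2) (var 4)) (var 0)) colour_body) s
    (\<lambda>s'. s' 1 4 = n \<and> (\<forall>j<2 + 8 * (n * n). s' 0 j = s 0 j) \<and>
       (\<forall>j<2 * n. s' 0 (2 + 8 * (n * n) + j) = (if j < n then 1 else 0)))"
proof (rule reaches_weaken)
  define I where "I i s' \<longleftrightarrow> s' 1 4 = n \<and> s' 1 0 = i \<and> (\<forall>j<2 + 8 * (n * n). s' 0 j = s 0 j) \<and>
       (\<forall>j<i. s' 0 (2 + 8 * (n * n) + j) = (if j < n then 1 else 0))" for i and s' :: mem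
  show "reaches K M (Loop (Sub (Mul (Num 2) (var 4)) (var 0)) colour_body) s (I (2 * n))"
  proof (rule reaches_Loop)
    fix i r assume i: "i < 2 * n" and r: "I i r"
    have r': "r (Suc 0) 4 = n" "r (Suc 0) 0 = i" using r by (auto simp: I_def)
    have "cbounded K colour_body r" unfolding colour_body_def using r' i K_idx by simp
    moreover have "step colour_body r 0 = (r 0)(2 + 8 * (n * n) + i := (if i < n then 1 else 0))"
      "step colour_body r 1 = (r 1)(0 := Suc i)"
      unfolding colour_body_def using r' by (auto simp: fun_eq_iff)
    then have "I (Suc i) (step colour_body r)" using r by (auto simp: I_def less_Suc_eq)
    ultimately show "eval (Sub (Mul (Num 2) (var 4)) (var 0)) r \<noteq> 0 \<and>
      ebounded K (Sub (Mul (Num 2) (var 4)) (var 0)) r \<and>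
      cbounded K colour_body r \<and> I (Suc i) (step colour_body r)"
      using r' i K_idx by simp
  next
    fix r assume "I (2 * n) r"
    then show "eval (Sub (Mul (Num 2) (var 4)) (var 0)) r = 0 \<and>
      ebounded K (Sub (Mul (Num 2) (var 4)) (var 0)) r"
      using K_idx by (simp add: I_def)
  next
    show "2 * n < M" using M_big by simp
  qed (use assms in \<open>simp add: I_def\<close>)
  fix s' assume "I (2 * n) s'"
  then show "s' 1 4 = n \<and> (\<forall>j<2 + 8 * (n * n). s' 0 j = s 0 j) \<and>
       (\<forall>j<2 * n. s' 0 (2 + 8 * (n * n) + j) = (if j < n then 1 else 0))"
    unfolding I_def by blast
qed

lemma fds_word_holdsI:
  assumes "s 0 0 = 1 + 8 * (n * n) + 2 * n" "s 0 1 = 2 * n"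
    and "\<forall>j<4 * (n * n). s 0 (2 + 2 * j) = out_num p q z (j div (2 * n)) (j mod (2 * n)) \<and>
       s 0 (3 + 2 * j) = out_den p q z (j div (2 * n)) (j mod (2 * n))"
    and "\<forall>j<2 * n. s 0 (2 + 8 * (n * n) + j) = (if j < n then 1 else 0)"
  shows "holds_word s (fds_word p q z)"
  unfolding holds_word_def length_fds_word z0
proof (intro conjI allI impI)
  fix j assume j: "j < 1 + 8 * n\<^sup>2 + 2 * n"
  show "s 0 (Suc j) = fds_word p q z ! j"
  proof (cases "j = 0")
    case True
    then show ?thesis using assms(2) by (simp add: fds_word_def z0 del: upt_Suc)
  next
    case j0: False
    show ?thesis
    proof (cases "j \<le> 8 * n\<^sup>2")
      case True
      define i where "i = (j - 1) div 2"
      have i: "i < 4 * (n * n)" using True j0 by (simp add: i_def power2_eq_square)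
      have nth: "fds_word p q z ! j = (if odd j then out_num p q z (i div (2 * n)) (i mod (2 * n))
          else out_den p q z (i div (2 * n)) (i mod (2 * n)))"
        using j j0 True by (simp add: fds_word_def z0 Let_def i_def del: upt_Suc)
      have "Suc j = (if odd j then 2 + 2 * i else 3 + 2 * i)"
        using j0 unfolding i_def by presburger
      then show ?thesis using assms(3) i nth by auto
    next
      case False
      define i where "i = j - (1 + 8 * n\<^sup>2)"
      have "i < 2 * n" "Suc j = 2 + 8 * (n * n) + i" using j False by (auto simp: i_def power2_eq_square)
      moreover have "fds_word p q z ! j = (if i < n then 1 else 0)"
        using j j0 False by (simp add: fds_word_def z0 i_def del: upt_Suc)
      ultimately show ?thesis using assms(4) by simp
    qed
  qed
qed (use assms(1) in \<open>simp add: power2_eq_square\<close>)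

lemma reaches_reduction:
  assumes "holds_word s z"
  shows "reaches K M (reduction_prog p q) s (\<lambda>s'. holds_word s' (fds_word p q z))"
  unfolding reduction_prog_def
proof (rule reaches_Seq[OF reaches_degree[OF assms]])
  have M1: "1 \<le> M" using M_big by simp
  fix s1 assume s1: "s1 = s(1 := (s 1)(0 := n, 1 := deg_num z, 2 := deg_den z))"
  have h1: "s1 0 = s 0" by (simp add: s1)
  have s01: "s 0 (Suc 0) = n" using assms len by (simp add: holds_word_def z0)
  show "reaches K M (Seq (setup_prog p q)
    (Seq (Loop (Sub (Add (Arr 0 (Num 0)) (Num 1)) (var 0)) copy_body)
    (Seq (assign 0 (Num 0))
    (Seq (Loop (Sub (Mul (Num 4) (Mul (var 4) (var 4))) (var 0)) build_body)
    (Seq (assign 0 (Num 0))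
    (Seq (Loop (Sub (Mul (Num 2) (var 4)) (var 0)) colour_body)
         finish_prog)))))) s1 (\<lambda>s'. holds_word s' (fds_word p q z))"
  proof (rule reaches_Seq)
    show "reaches K M (setup_prog p q) s1 (\<lambda>r. holds_word r z \<and> ready r \<and> r 1 0 = 0)"
      by (rule reaches_step[OF _ _ M1])
        (use assms s01 h1 K_pq K_idx in \<open>auto simp: setup_prog_def s1 holds_word_def ready_def clique_size_def z0\<close>)
  next
    fix s2 assume "holds_word s2 z \<and> ready s2 \<and> s2 1 0 = 0"
    then have s2: "holds_word s2 z" "ready s2" "s2 1 0 = 0" by auto
    show "reaches K M (Seq (Loop (Sub (Add (Arr 0 (Num 0)) (Num 1)) (var 0)) copy_body)
      (Seq (assign 0 (Num 0))
      (Seq (Loop (Sub (Mul (Num 4) (Mul (var 4) (var 4))) (var 0)) build_body)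
      (Seq (assign 0 (Num 0))
      (Seq (Loop (Sub (Mul (Num 2) (var 4)) (var 0)) colour_body)
           finish_prog))))) s2 (\<lambda>s'. holds_word s' (fds_word p q z))"
    proof (rule reaches_Seq[OF reaches_copy[OF s2]], rule reaches_Seq)
      fix s3 assume "ready s3 \<and> copied s3"
      then show "reaches K M (assign 0 (Num 0)) s3 (\<lambda>r. ready r \<and> copied r \<and> r 1 0 = 0)"
        by (intro reaches_step[OF _ _ M1]) (auto simp: ready_def copied_def)
    next
      fix s4 assume "ready s4 \<and> copied s4 \<and> s4 1 0 = 0"
      then have s4: "ready s4" "copied s4" "s4 1 0 = 0" by auto
      show "reaches K M (Seq (Loop (Sub (Mul (Num 4) (Mul (var 4) (var 4))) (var 0)) build_body)
        (Seq (assign 0 (Num 0))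
        (Seq (Loop (Sub (Mul (Num 2) (var 4)) (var 0)) colour_body)
             finish_prog))) s4 (\<lambda>s'. holds_word s' (fds_word p q z))"
      proof (rule reaches_Seq[OF reaches_build[OF s4]], rule reaches_Seq)
        let ?Q = "\<lambda>r. \<forall>j<4 * (n * n). r 0 (2 + 2 * j) = out_num p q z (j div (2 * n)) (j mod (2 * n)) \<and>
          r 0 (3 + 2 * j) = out_den p q z (j div (2 * n)) (j mod (2 * n))"
        fix s5 :: mem assume "s5 1 4 = n \<and> ?Q s5"
        then show "reaches K M (assign 0 (Num 0)) s5 (\<lambda>r. r 1 4 = n \<and> r 1 0 = 0 \<and> ?Q r)"
          by (intro reaches_step[OF _ _ M1]) auto
      next
        let ?Q = "\<lambda>r. \<forall>j<4 * (n * n). r 0 (2 + 2 * j) = out_num p q z (j div (2 * n)) (j mod (2 * n)) \<and>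
          r 0 (3 + 2 * j) = out_den p q z (j div (2 * n)) (j mod (2 * n))"
        fix s6 :: mem assume "s6 1 4 = n \<and> s6 1 0 = 0 \<and> ?Q s6"
        then have s6: "s6 1 4 = n" "s6 1 0 = 0" and Q: "?Q s6" by auto
        show "reaches K M (Seq (Loop (Sub (Mul (Num 2) (var 4)) (var 0)) colour_body) finish_prog) s6
          (\<lambda>s'. holds_word s' (fds_word p q z))"
        proof (rule reaches_Seq[OF reaches_colour[of s6, OF s6]])
          fix s7 :: mem assume s7: "s7 1 4 = n \<and> (\<forall>j<2 + 8 * (n * n). s7 0 j = s6 0 j) \<and>
            (\<forall>j<2 * n. s7 0 (2 + 8 * (n * n) + j) = (if j < n then 1 else 0))"
          have "?Q s7"
          proof (intro allI impI)
            fix j assume j: "j < 4 * (n * n)"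
            then have "2 + 2 * j < 2 + 8 * (n * n)" "3 + 2 * j < 2 + 8 * (n * n)" by auto
            then show "s7 0 (2 + 2 * j) = out_num p q z (j div (2 * n)) (j mod (2 * n)) \<and>
              s7 0 (3 + 2 * j) = out_den p q z (j div (2 * n)) (j mod (2 * n))"
              using s7 Q j by simp
          qed
          moreover have "step finish_prog s7 0 = (s7 0)(1 := 2 * n, 0 := 1 + 8 * (n * n) + 2 * n)"
            using s7 by (simp add: finish_prog_def)
          ultimately have "holds_word (step finish_prog s7) (fds_word p q z)"
            using s7 by (intro fds_word_holdsI) auto
          moreover have "cbounded K finish_prog s7" unfolding finish_prog_def using s7 K_idx by simp
          ultimately show "reaches K M finish_prog s7 (\<lambda>s'. holds_word s' (fds_word p q z))"
            by (intro reaches_step[OF _ _ M1])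
        qed
      qed
    qed
  qed
qed

end

section \<open>The program that decides membership from an answer\<close>

text \<open>
  The program computing the reduction expects array 1 to be empty, so the answer word is first moved to
  an array \<open>m\<close> that this program does not mention.
\<close>

definition stash_body :: "nat \<Rightarrow> com" where
  "stash_body m = Seq (Store m (Arr (Suc m) (Num 0)) (Arr 1 (Arr (Suc m) (Num 0))))
     (Seq (Store 1 (Arr (Suc m) (Num 0)) (Num 0))
          (Store (Suc m) (Num 0) (Sub (Arr (Suc m) (Num 0)) (Num 1))))"

definition stash_prog :: "nat \<Rightarrow> com" where
  "stash_prog m = Seq (Store (Suc m) (Num 0) (Arr 1 (Num 0)))
     (Seq (Loop (Arr (Suc m) (Num 0)) (stash_body m)) (Store 1 (Num 0) (Num 0)))"

definition entry :: "word \<Rightarrow> nat \<Rightarrow> nat" where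
  "entry y v = (if v < length y then y ! v else 0)"

lemma reaches_stash:
  assumes m: "2 \<le> m" and K: "length y + 1 \<le> K" "\<And>v. entry y v \<le> K" and M: "length y < M"
  shows "reaches K M (stash_prog m) (load [x, y])
    (\<lambda>s. (\<forall>a<m. s a = load [x] a) \<and> (\<forall>v. s m (Suc v) = entry y v))"
proof -
  define L where "L = length y"
  define s0 where "s0 = load [x, y]"
  have s0: "s0 1 0 = L" "\<And>v. s0 1 (Suc v) = entry y v" "\<And>a j. 2 \<le> a \<Longrightarrow> s0 a j = 0"
    by (auto simp: s0_def load_def L_def entry_def)
  \<comment> \<open>The counter runs downwards and lives in array \<open>m + 1\<close>, outside the
    array being emptied: cells above \<open>L - i\<close> have already been moved. Cell 0 of array
    1, the length, is cleared after the loop.\<close>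
  define I where "I i s \<longleftrightarrow> s (Suc m) 0 = L - i \<and> (\<forall>a<m. a \<noteq> 1 \<longrightarrow> s a = s0 a) \<and>
    (\<forall>j. s 1 j = (if L - i < j then 0 else s0 1 j)) \<and>
    (\<forall>j. s m j = (if L - i < j then s0 1 j else 0))" for i s
  have out: "s0 1 j = 0" if "L < j" for j using that by (auto simp: s0_def load_def L_def)
  have sK: "s0 1 j \<le> K" for j by (cases j) (use s0 K in \<open>auto simp: L_def\<close>)
  have M1: "1 \<le> M" using M by simp
  show ?thesis unfolding stash_prog_def s0_def[symmetric]
  proof (rule reaches_Seq)
    have "step (Store (Suc m) (Num 0) (Arr 1 (Num 0))) s0 = s0(Suc m := (s0 (Suc m))(0 := L))" using s0 by simp
    moreover have "I 0 (s0(Suc m := (s0 (Suc m))(0 := L)))"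
      using m s0(1,3) out by (auto simp: I_def)
    ultimately show "reaches K M (Store (Suc m) (Num 0) (Arr 1 (Num 0))) s0 (I 0)"
      by (intro reaches_step[OF _ _ M1]) (use s0 K in \<open>auto simp: L_def\<close>)
  next
    fix s1 assume s1: "I 0 s1"
    show "reaches K M (Seq (Loop (Arr (Suc m) (Num 0)) (stash_body m)) (Store 1 (Num 0) (Num 0))) s1
      (\<lambda>s. (\<forall>a<m. s a = load [x] a) \<and> (\<forall>v. s m (Suc v) = entry y v))"
    proof (rule reaches_Seq)
      show "reaches K M (Loop (Arr (Suc m) (Num 0)) (stash_body m)) s1 (I L)"
      proof (rule reaches_Loop)
        fix i r assume i: "i < L" and r: "I i r"
        define c where "c = L - i"
        have c: "0 < c" "c \<le> L" "L - Suc i = c - 1" using i by (auto simp: c_def)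
        have rc: "r (Suc m) 0 = c" "r 1 c = s0 1 c" using r by (auto simp: I_def c_def)
        have st: "step (stash_body m) r =
          r(m := (r m)(c := s0 1 c), 1 := (r 1)(c := 0), Suc m := (r (Suc m))(0 := c - 1))"
          unfolding stash_body_def using rc m by (simp add: fun_eq_iff)
        have "I (Suc i) (step (stash_body m) r)"
          unfolding I_def st c(3) using r m c(1) unfolding I_def c_def[symmetric] by auto
        moreover have "cbounded K (stash_body m) r"
          unfolding stash_body_def using rc m c sK K by (simp add: L_def)
        ultimately show "eval (Arr (Suc m) (Num 0)) r \<noteq> 0 \<and> ebounded K (Arr (Suc m) (Num 0)) r \<and>
          cbounded K (stash_body m) r \<and> I (Suc i) (step (stash_body m) r)"
          using rc c K by (simp add: L_def)
      next
        fix r assume "I L r"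
        then show "eval (Arr (Suc m) (Num 0)) r = 0 \<and> ebounded K (Arr (Suc m) (Num 0)) r"
          by (simp add: I_def)
      qed (use s1 M in \<open>auto simp: L_def\<close>)
    next
      fix s2 assume s2: "I L s2"
      have st: "step (Store 1 (Num 0) (Num 0)) s2 = s2(1 := (s2 1)(0 := 0))" by simp
      have "(s2(1 := (s2 1)(0 := 0))) a = load [x] a" if "a < m" for a
      proof (cases "a = 1")
        case True
        then show ?thesis using s2 by (auto simp: I_def load_def fun_eq_iff)
      next
        case False
        then show ?thesis using s2 that by (auto simp: I_def s0_def load_def fun_eq_iff)
      qed
      moreover have "(s2(1 := (s2 1)(0 := 0))) m (Suc v) = entry y v" for v
        using s2 m s0(2) by (auto simp: I_def)
      ultimately show "reaches K M (Store 1 (Num 0) (Num 0)) s2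
        (\<lambda>s. (\<forall>a<m. s a = load [x] a) \<and> (\<forall>v. s m (Suc v) = entry y v))"
        by (intro reaches_step[OF _ _ M1]) (simp, unfold st, blast)
    qed
  qed
qed

definition pair_guard :: "nat \<Rightarrow> aexp" where
  "pair_guard m = both (Arr m (Add (Num 1) (Div (var 0) (var 4))))
     (Arr m (Add (Num 1) (Sub (var 0) (Mul (Div (var 0) (var 4)) (var 4)))))"

text \<open>The second run of \<open>sum_prog\<close> reuses cells 1 and 2, so the degree has to be
  moved away.\<close>

definition save_prog :: com where
  "save_prog = Seq (assign 7 (var 1)) (Seq (assign 8 (var 2)) (Seq (assign 4 (Arr 0 (Num 1)))
     (Seq (assign 9 (Num 0)) (assign 0 (Num 0)))))"

definition count_body :: "nat \<Rightarrow> com" where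
  "count_body m = Seq (assign 9 (Add (var 9) (Sub (Num 1) (Sub (Num 1) (Arr m (Add (Num 1) (var 0)))))))
     (assign 0 (Add (var 0) (Num 1)))"

definition gain :: "nat \<Rightarrow> aexp" where
  "gain N = Add (Mul (Mul (Mul (var 1) (var 8)) (Num N)) (var 3))
                (Mul (Mul (Mul (var 7) (var 2)) (Num N)) (Mul (var 5) (var 5)))"

definition threshold :: "nat \<Rightarrow> aexp" where
  "threshold N = Mul (Mul (Mul (Mul (var 7) (var 2)) (Num (N + 2))) (var 9)) (var 3)"

text \<open>\<open>k - (k - t)\<close> is the minimum of \<open>k\<close> and \<open>t\<close>.
  Since \<open>t\<close> is a rounded-down quotient, \<open>q * t \<le> p * n\<close> always holds,
  and a zero difference \<open>p * n - q * t\<close> tests equality.\<close>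

definition verdict_prog :: "nat \<Rightarrow> nat \<Rightarrow> nat \<Rightarrow> com" where
  "verdict_prog p q N =
     Seq (assign 3 (Div (Mul (Num p) (var 4)) (Num q)))
    (Seq (assign 5 (Sub (var 9) (Sub (var 9) (var 3))))
    (Seq (Store 0 (Num 1)
           (both (both (Sub (Num 1) (Sub (Mul (Num p) (var 4)) (Mul (Num q) (var 3)))) (Sub (var 3) (Num 1)))
                 (Sub (gain N) (threshold N))))
         (Store 0 (Num 0) (Num 1))))"

definition decision_prog :: "nat \<Rightarrow> nat \<Rightarrow> nat \<Rightarrow> nat \<Rightarrow> com" where
  "decision_prog p q N m =
     Seq (sum_prog (Arr 0 (Num 1)) (Num 1))
    (Seq save_prog
    (Seq (Loop (Sub (var 4) (var 0)) (count_body m))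
    (Seq (sum_prog (Mul (var 4) (var 4)) (pair_guard m))
         (verdict_prog p q N))))"

context bounded_word
begin

lemma selected_iff: "v \<in> selected z y \<longleftrightarrow> v < n \<and> entry y v \<noteq> 0"
  by (auto simp: selected_def entry_def z0)

lemma reaches_count:
  assumes m: "2 \<le> m" and s: "s 1 4 = n" "s 1 0 = 0" "s 1 9 = 0" "\<And>v. s m (Suc v) = entry y v"
    and yK: "\<And>v. entry y v \<le> K"
  shows "reaches K M (Loop (Sub (var 4) (var 0)) (count_body m)) s
    (\<lambda>s'. s' = s(1 := (s 1)(0 := n, 9 := card (selected z y))))"
proof -
  define k where "k i = card (selected z y \<inter> {..<i})" for i
  define S where "S i = s(1 := (s 1)(0 := i, 9 := k i))" for i
  have fin: "finite (selected z y \<inter> {..<i})" for i by simp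
  have k: "k (Suc i) = k i + (1 - (1 - entry y i))" if "i < n" for i
  proof (cases "entry y i = 0")
    case True
    then have "selected z y \<inter> {..<Suc i} = selected z y \<inter> {..<i}"
      by (auto simp: selected_iff less_Suc_eq)
    then show ?thesis using True by (simp add: k_def)
  next
    case False
    then have "selected z y \<inter> {..<Suc i} = insert i (selected z y \<inter> {..<i})"
      using that by (auto simp: selected_iff less_Suc_eq)
    then show ?thesis using False by (simp add: k_def)
  qed
  have kle: "k i \<le> i" for i using card_mono[of "{..<i}" "selected z y \<inter> {..<i}"] by (simp add: k_def)
  have "reaches K M (Loop (Sub (var 4) (var 0)) (count_body m)) s (\<lambda>s'. s' = S n)"
  proof (rule reaches_Loop[where I = "\<lambda>i s'. s' = S i"])
    fix i r assume i: "i < n" and r: "r = S i"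
    have "eval (Sub (var 4) (var 0)) r \<noteq> 0" "ebounded K (Sub (var 4) (var 0)) r"
      unfolding r S_def using s i K_idx by auto
    moreover have "cbounded K (count_body m) r"
      unfolding r S_def count_body_def using s m i K_idx yK kle[of i] by simp
    moreover have "step (count_body m) r = S (Suc i)"
      unfolding r S_def count_body_def using s m k[OF i] by (simp add: fun_eq_iff)
    ultimately show "eval (Sub (var 4) (var 0)) r \<noteq> 0 \<and> ebounded K (Sub (var 4) (var 0)) r \<and>
      cbounded K (count_body m) r \<and> step (count_body m) r = S (Suc i)" by blast
  next
    fix r assume r: "r = S n"
    show "eval (Sub (var 4) (var 0)) r = 0 \<and> ebounded K (Sub (var 4) (var 0)) r"
      unfolding r S_def using s K_idx by auto
  next
    show "s = S 0" using s by (auto simp: S_def k_def fun_eq_iff)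
  qed (use M_big in simp)
  moreover have "k n = card (selected z y)"
    using selected_subset[of z y] by (simp add: k_def z0 Int_absorb2)
  ultimately show ?thesis by (simp add: S_def)
qed

lemma reaches_pairs:
  assumes m: "2 \<le> m" and s: "s 1 4 = n" "holds_word s z" "\<And>v. s m (Suc v) = entry y v"
    and yK: "\<And>v. entry y v \<le> K"
  shows "reaches K M (sum_prog (Mul (var 4) (var 4)) (pair_guard m)) s
    (\<lambda>s'. s' = s(1 := (s 1)(0 := n * n, 1 := frac_num (wnum z) (wden z) (sel_pair z y) (n * n),
                                2 := frac_den (wden z) (sel_pair z y) (n * n))))"
proof (rule reaches_sum_prog)
  fix i assume i: "i < n * n"
  define S where "S = s(1 := (s 1)(0 := i, 1 := frac_num (wnum z) (wden z) (sel_pair z y) i,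
                                2 := frac_den (wden z) (sel_pair z y) i))"
  have S: "S (Suc 0) 4 = n" "S (Suc 0) 0 = i" "\<And>v. S m (Suc v) = entry y v"
    using s m by (auto simp: S_def)
  have v: "i - i div n * n = i mod n" "i div n * n \<le> i" "i div n < n" "i mod n < n"
    using i n_pos by (auto simp: minus_div_mult_eq_mod less_mult_imp_div_less)
  have "eval (pair_guard m) S \<noteq> 0 \<longleftrightarrow> sel_pair z y i"
    unfolding pair_guard_def sel_pair_def selected_iff z0 using S v by (simp add: eval_both)
  moreover have "ebounded K (pair_guard m) S"
  proof -
    have "i mod n + 1 \<le> K" "i div n * n \<le> K" using v(2,4) i K_idx by linarith+
    then show ?thesis unfolding pair_guard_def using S v(1,3) yK i K_idx
      by (simp add: ebounded_both del: minus_div_mult_eq_mod minus_mod_eq_div_mult)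
  qed
  ultimately show "(eval (pair_guard m) S \<noteq> 0 \<longleftrightarrow> sel_pair z y i) \<and> ebounded K (pair_guard m) S" by blast
  show "s 0 (2 + 2 * i) = wnum z i \<and> s 0 (3 + 2 * i) = wden z i \<and> wden z i \<noteq> 0"
    using holds_pair[OF s(2) i] gw i by (simp add: graph_word_def)
  show "(frac_num (wnum z) (wden z) (sel_pair z y) i + frac_den (wden z) (sel_pair z y) i) * (wnum z i + wden z i) \<le> K"
    using frac_step_le_wsize[OF gw i] K_big by (rule order_trans)
qed (use s m K_idx M_big in auto)

lemma reaches_decision:
  assumes m: "2 \<le> m" and s: "holds_word s z" "\<And>v. s m (Suc v) = entry y v"
    and yK: "\<And>v. entry y v \<le> K" and K4: "2 * (2 ^ wsize z * 2 ^ wsize z * (N + 2) * (2 ^ wsize z * 2 ^ wsize z)) \<le> K"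
  shows "reaches K M (decision_prog p q N m) s (\<lambda>s'. holds_word s' (if accepts p q N z y then [1] else [0]))"
  unfolding decision_prog_def
proof (rule reaches_Seq[OF reaches_degree[OF s(1)]], rule reaches_Seq)
  have M1: "1 \<le> M" using M_big by simp
  define A where "A = deg_num z"
  define B where "B = deg_den z"
  define k where "k = card (selected z y)"
  define C where "C = frac_num (wnum z) (wden z) (sel_pair z y) (n * n)"
  define D where "D = frac_den (wden z) (sel_pair z y) (n * n)"
  define T where "T = clique_size p q z"
  define H :: nat where "H = 2 ^ wsize z"
  have s01: "s 0 (Suc 0) = n" using s len by (simp add: holds_word_def z0)
  {
    fix s1 assume s1: "s1 = s(1 := (s 1)(0 := n, 1 := deg_num z, 2 := deg_den z))"
    show "reaches K M save_prog s1 (\<lambda>r. r 0 = s 0 \<and> (\<forall>v. r m (Suc v) = entry y v) \<and>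
       r 1 7 = A \<and> r 1 8 = B \<and> r 1 4 = n \<and> r 1 9 = 0 \<and> r 1 0 = 0)"
      by (rule reaches_step[OF _ _ M1])
        (use s01 s m K_idx deg_le_K in \<open>auto simp: save_prog_def s1 A_def B_def\<close>)
  next
    fix s2 :: mem assume s2: "s2 0 = s 0 \<and> (\<forall>v. s2 m (Suc v) = entry y v) \<and>
       s2 1 7 = A \<and> s2 1 8 = B \<and> s2 1 4 = n \<and> s2 1 9 = 0 \<and> s2 1 0 = 0"
    show "reaches K M (Seq (Loop (Sub (var 4) (var 0)) (count_body m))
      (Seq (sum_prog (Mul (var 4) (var 4)) (pair_guard m)) (verdict_prog p q N))) s2
      (\<lambda>s'. holds_word s' (if accepts p q N z y then [1] else [0]))"
    proof (rule reaches_Seq)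
      show "reaches K M (Loop (Sub (var 4) (var 0)) (count_body m)) s2
        (\<lambda>s'. s' = s2(1 := (s2 1)(0 := n, 9 := card (selected z y))))"
        using s2 by (intro reaches_count m yK) auto
    next
      fix s3 assume s3: "s3 = s2(1 := (s2 1)(0 := n, 9 := card (selected z y)))"
      show "reaches K M (Seq (sum_prog (Mul (var 4) (var 4)) (pair_guard m)) (verdict_prog p q N)) s3
        (\<lambda>s'. holds_word s' (if accepts p q N z y then [1] else [0]))"
      proof (rule reaches_Seq)
        show "reaches K M (sum_prog (Mul (var 4) (var 4)) (pair_guard m)) s3
          (\<lambda>s'. s' = s3(1 := (s3 1)(0 := n * n, 1 := C, 2 := D)))"
          unfolding C_def D_def using s2 s m by (intro reaches_pairs yK) (auto simp: s3 holds_word_def)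
      next
        fix s4 assume s4: "s4 = s3(1 := (s3 1)(0 := n * n, 1 := C, 2 := D))"
        define l where "l = min k T"
        have v: "s4 (Suc 0) (Suc 0) = C" "s4 (Suc 0) 2 = D" "s4 (Suc 0) 7 = A" "s4 (Suc 0) 8 = B"
          "s4 (Suc 0) 4 = n" "s4 (Suc 0) 9 = k" using s2 by (simp_all add: s4 s3 k_def)
        define s5 where "s5 = s4(1 := (s4 1)(3 := T, 5 := l))"
        have w: "s5 (Suc 0) (Suc 0) = C" "s5 (Suc 0) 2 = D" "s5 (Suc 0) 7 = A" "s5 (Suc 0) 8 = B"
          "s5 (Suc 0) 4 = n" "s5 (Suc 0) 9 = k" "s5 (Suc 0) 3 = T" "s5 (Suc 0) 5 = l"
          using v by (simp_all add: s5_def)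
        have kn: "k \<le> n" using card_mono[OF _ selected_subset[of z y]] by (simp add: k_def z0)
        have Tn: "T \<le> n" using t_le by (simp add: T_def)
        have nH: "n \<le> H" using nth_less_wsize[of 0 z] len z0 by (simp add: H_def)
        have H1: "1 \<le> H" by (simp add: H_def)
        have cd: "C \<le> H" "D \<le> H"
          using frac_le_wsize[OF gw, of "n * n" "sel_pair z y"] by (simp_all add: C_def D_def H_def)
        have ab: "A \<le> H" "B \<le> H" using deg_le by (simp_all add: A_def B_def H_def)
        \<comment> \<open>The intermediate products on both sides of the comparison fit this
          pattern, with factors 1 filling the gaps; the doubled bound serves the sum in
          \<open>gain\<close>.\<close>
        have X: "a * b * c * e \<le> K" "2 * (a * b * c * e) \<le> K"
          if "a \<le> H" "b \<le> H" "c \<le> N + 2" "e \<le> H * H" for a b c e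
        proof -
          have "a * b * c * e \<le> H * H * (N + 2) * (H * H)" using that by (intro mult_le_mono)
          then show "a * b * c * e \<le> K" "2 * (a * b * c * e) \<le> K" using K4 by (auto simp: H_def)
        qed
        have HH: "k \<le> H" "T \<le> H" "l \<le> H" using kn Tn nH by (auto simp: l_def)
        then have HH2: "k * T \<le> H * H" "l * l \<le> H * H" "T \<le> H * H" "k \<le> H * H" "1 \<le> H * H"
          using H1 mult_le_mono[of T H 1 H] mult_le_mono[of k H 1 H] by (auto intro!: mult_le_mono)
        have "l \<le> K" using kn K_idx by (simp add: l_def)
        then have gb: "ebounded K (gain N) s5" "ebounded K (threshold N) s5"
          using X(1)[of C B 1 1] X(1)[of C B N 1] X(1)[of C B N T] X(1)[of A D 1 1] X(1)[of A D N 1]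
            X(1)[of A D N "l * l"] X(2)[of C B N T] X(2)[of A D N "l * l"] X(1)[of A D "N + 2" 1]
            X(1)[of A D "N + 2" k] X(1)[of A D "N + 2" "k * T"] X(1)[of l l 1 1] X(1)[of 1 1 "N + 2" 1]
            cd ab HH HH2 H1 kn Tn K_idx deg_le_K X(1)[of C 1 1 1] X(1)[of D 1 1 1]
          by (simp_all add: gain_def threshold_def w A_def[symmetric] B_def[symmetric] mult.assoc)
        have ev: "eval (gain N) s5 = C * B * N * T + A * D * N * (l * l)"
          "eval (threshold N) s5 = A * D * (N + 2) * k * T"
          by (simp_all add: gain_def threshold_def w)
        have qT: "q * T \<le> p * n" by (simp add: T_def clique_size_def z0)
        define c1 where "c1 = Seq (assign 3 (Div (Mul (Num p) (var 4)) (Num q)))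
          (assign 5 (Sub (var 9) (Sub (var 9) (var 3))))"
        define e where "e = both (both (Sub (Num 1) (Sub (Mul (Num p) (var 4)) (Mul (Num q) (var 3)))) (Sub (var 3) (Num 1)))
                 (Sub (gain N) (threshold N))"
        have c1: "step c1 s4 = s5" unfolding c1_def s5_def using v
          by (simp add: T_def clique_size_def z0 l_def min_def fun_eq_iff)
        have c1b: "cbounded K c1 s4" unfolding c1_def using v K_pq K_idx kn Tn
          by (simp add: T_def clique_size_def z0)
        have acc: "accepts p q N z y \<longleftrightarrow> q * T = p * n \<and> 2 \<le> T \<and>
          A * D * (N + 2) * k * T < C * B * N * T + A * D * N * (l * l)"
          unfolding accepts_def Let_def z0 by (simp only: A_def B_def C_def D_def T_def k_def l_def)
        have e: "eval e s5 = (if accepts p q N z y then 1 else 0)"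
          unfolding e_def eval_both eval.simps(4) ev acc using qT w by auto
        have "n \<le> K" "T \<le> K" using K_idx Tn by auto
        then have eb: "ebounded K e s5"
          unfolding e_def using gb w K_pq K_idx qT by (simp add: ebounded_both)
        have "step (verdict_prog p q N) s4 = s5(0 := (s5 0)(1 := if accepts p q N z y then 1 else 0, 0 := 1))"
          unfolding verdict_prog_def e_def[symmetric] using c1 e by (simp add: c1_def)
        moreover have "cbounded K (verdict_prog p q N) s4"
          unfolding verdict_prog_def e_def[symmetric] using c1 c1b eb K_idx by (simp add: c1_def)
        ultimately show "reaches K M (verdict_prog p q N) s4
          (\<lambda>s'. holds_word s' (if accepts p q N z y then [1] else [0]))"
          by (intro reaches_step[OF _ _ M1]) (simp_all add: holds_word_def)
      qed
    qed
  }
qed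

end

section \<open>Polynomial time bounds\<close>

text \<open>From \<open>2 * n * n \<le> l\<close> follow
  \<open>8 * n * n + 2 * n \<le> 5 * l\<close> and \<open>4 * n * n + 2 * n \<le> 3 * l\<close>,
  which explains the coefficients 5 and 3. The value bound is a power of 2 with exponent linear in
  \<open>l\<close>, so its bit length, which enters the running time, is linear too.\<close>

lemma bounded_word_standard:
  assumes "graph_word z n" "0 < n" "p \<le> q" "wsize z \<le> l"
  shows "bounded_word z n p q (2 ^ (p + q + N + 20 + 5 * l)) (3 * l + 5)"
    and "2 * (2 ^ wsize z * 2 ^ wsize z * (N + 2) * (2 ^ wsize z * 2 ^ wsize z)) \<le> (2 :: nat) ^ (p + q + N + 20 + 5 * l)"
proof -
  define e where "e = p + q + N + 20 + 5 * l"
  have z: "z ! 0 = n" "length z = 1 + 2 * (n * n)"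
    using assms(1) by (simp_all add: graph_word_def power2_eq_square)
  have nl: "2 * (n * n) \<le> l" using length_le_wsize[of z] z(2) assms(4) by linarith
  have nn: "n \<le> n * n" using assms(2) by simp
  have le: "k \<le> (2::nat) ^ e" if "k \<le> e" for k
    using that less_exp[of e] by linarith
  have pe: "p + n \<le> e" using nl nn unfolding e_def by linarith
  have "p * n \<le> 2 ^ p * 2 ^ n" by (intro mult_le_mono less_imp_le less_exp)
  also have "\<dots> \<le> (2::nat) ^ e" unfolding power_add[symmetric] using pe by (intro power_increasing) auto
  finally have pn: "p * n \<le> 2 ^ e" .
  have "(2::nat) ^ (2 * wsize z) \<le> 2 ^ e" using assms(4) by (intro power_increasing) (auto simp: e_def)
  moreover have "8 * (n * n) + 2 * n + 20 \<le> e" using nl nn unfolding e_def by linarith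
  moreover have "4 * (n * n) + 2 * n + 2 < 3 * l + 5" using nl nn by linarith
  ultimately show "bounded_word z n p q (2 ^ (p + q + N + 20 + 5 * l)) (3 * l + 5)"
    unfolding e_def[symmetric] using assms clique_size_le[OF assms(3), of z] z(1) pn le
    by unfold_locales (auto simp: e_def)
  have "2 * (2 ^ wsize z * 2 ^ wsize z * (N + 2) * (2 ^ wsize z * 2 ^ wsize z)) =
    2 ^ (1 + 4 * wsize z) * (N + 2)"
  proof -
    have "1 + 4 * wsize z = 1 + (wsize z + wsize z + (wsize z + wsize z))" by simp
    then show ?thesis by (simp only: power_add power_one_right ac_simps)
  qed
  also have "\<dots> \<le> 2 ^ (1 + 4 * wsize z) * 2 ^ (N + 2)" by (intro mult_le_mono less_imp_le less_exp order_refl)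
  also have "\<dots> \<le> 2 ^ e" unfolding power_add[symmetric] using assms(4) by (intro power_increasing) (auto simp: e_def)
  finally show "2 * (2 ^ wsize z * 2 ^ wsize z * (N + 2) * (2 ^ wsize z * 2 ^ wsize z)) \<le> (2 :: nat) ^ (p + q + N + 20 + 5 * l)"
    by (simp add: e_def)
qed

lemma bits_power: "bits (2 ^ e) = e + 1"
  using floorlog_power[of 1 2 e] by (simp add: floorlog_def)

lemma (in bounded_word) fds_word_le:
  assumes "x \<in> set (fds_word p q z)" shows "x \<le> K"
proof -
  have num: "out_num p q z u v \<le> K" "out_den p q z u v \<le> K" for u v
  proof -
    have "wnum z (n * u + v) \<le> K" "wden z (n * u + v) \<le> K" if "u < n" "v < n"
      using index_less[OF that] len by (intro entry_le; simp)+
    then show "out_num p q z u v \<le> K" "out_den p q z u v \<le> K"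
      using deg_le_K K_idx by (auto simp: out_num_def out_den_def z0)
  qed
  have "2 * n \<le> K" "1 \<le> K" using K_idx by auto
  then show ?thesis using assms num unfolding fds_word_def z0 Let_def by (auto split: if_splits)
qed

text \<open>Needed because \<open>runs_within\<close> charges the output besides the running
  time.\<close>

lemma (in bounded_word) wsize_fds_word: "wsize (fds_word p q z) \<le> (1 + 8 * (n * n) + 2 * n) * (bits K + 1)"
proof -
  have "wsize (fds_word p q z) \<le> (\<Sum>j<length (fds_word p q z). bits K + 1)"
    unfolding wsize_eq_sum by (intro sum_mono add_mono bits_mono fds_word_le) auto
  then show ?thesis by (simp add: length_fds_word z0 power2_eq_square)
qed

lemma poly_nat_mono: "x \<le> y \<Longrightarrow> poly (r :: nat poly) x \<le> poly r y"
  by (induction r) (auto intro!: mult_le_mono)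

lemma runs_withinE:
  assumes "runs_within c ws y b"
  obtains t s where "exec c (load ws) t s" "holds_word s y" "t + wsize y \<le> b"
  using assms out_word_holds unfolding runs_within_def by blast

lemma runs_withinI:
  assumes "exec c (load ws) t s" "holds_word s y" "t + wsize y \<le> b"
  shows "runs_within c ws y b"
  using assms holds_out_word unfolding runs_within_def by blast

text \<open>The program for \<open>f\<close> may leave anything outside its output word;
  \<open>reduction_prog\<close> initialises every other cell that it reads. Since outputs are
  charged, the polynomial for \<open>f\<close> also bounds the size of \<open>f x\<close>.\<close>

lemma polytime_fds_word:
  assumes f: "polytime_fun f" and gw: "\<And>x. \<exists>n. graph_word (f x) n \<and> 0 < n" and pq: "p \<le> q"
  shows "polytime_fun (\<lambda>x. fds_word p q (f x))"
proof -
  obtain c r where c: "\<And>x. runs_within c [x] (f x) (poly r (wsize x))"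
    using f unfolding polytime_fun_def by blast
  define c0 where "c0 = p + q + 0 + 20"
  define P where "P = r + [:csize (reduction_prog p q):] * ((3 * r + 5) * (5 * r + [:c0 + 2:])) +
    (5 * r + 1) * (5 * r + [:c0 + 2:])"
  have "runs_within (Seq c (reduction_prog p q)) [x] (fds_word p q (f x)) (poly P (wsize x))" for x
  proof -
    define z where "z = f x"
    define l where "l = poly r (wsize x)"
    define K :: nat where "K = 2 ^ (c0 + 5 * l)"
    define M where "M = 3 * l + 5"
    obtain n where n: "graph_word z n" "0 < n" using gw[of x] by (auto simp: z_def)
    obtain t s where t: "exec c (load [x]) t s" "holds_word s z" "t + wsize z \<le> l"
      using runs_withinE[OF c[of x]] unfolding z_def l_def by blast
    interpret bounded_word z n p q K M
      unfolding K_def M_def c0_def using t(3) by (intro bounded_word_standard(1) n pq) simp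
    obtain t' s' where t': "exec (reduction_prog p q) s t' s'"
      "t' \<le> csize (reduction_prog p q) * (M * (1 + bits K))" "holds_word s' (fds_word p q z)"
      using reaches_reduction[OF t(2)] unfolding reaches_def by blast
    have bK: "1 + bits K = 5 * l + (c0 + 2)" "bits K + 1 = 5 * l + (c0 + 2)" by (simp_all add: K_def bits_power)
    have "2 * (n * n) + 1 \<le> l" using length_le_wsize[of z] len t(3) by linarith
    then have "1 + 8 * (n * n) + 2 * n \<le> 5 * l + 1" using n_le by linarith
    then have "(1 + 8 * (n * n) + 2 * n) * (bits K + 1) \<le> (5 * l + 1) * (5 * l + (c0 + 2))"
      unfolding bK by (rule mult_le_mono1)
    then have "wsize (fds_word p q z) \<le> (5 * l + 1) * (5 * l + (c0 + 2))"
      using wsize_fds_word by linarith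
    moreover have "poly P (wsize x) = l + csize (reduction_prog p q) * (M * (1 + bits K)) + (5 * l + 1) * (5 * l + (c0 + 2))"
      unfolding P_def bK by (simp add: l_def M_def)
    ultimately have "t + t' + wsize (fds_word p q z) \<le> poly P (wsize x)" using t(3) t'(2) by linarith
    then show ?thesis using runs_withinI[OF exec_Seq[OF t(1) t'(1)]] t'(3) by (simp add: z_def)
  qed
  then show ?thesis unfolding polytime_fun_def by blast
qed

text \<open>Only \<open>x\<close> and \<open>y\<close> are given, so \<open>f x\<close> is computed
  again: \<open>y\<close> is moved to a fresh array, and \<open>exec_agree\<close> supplies the run
  of the program for \<open>f\<close> on what is left.\<close>

lemma polytime_accepts:
  assumes f: "polytime_fun f" and gw: "\<And>x. \<exists>n. graph_word (f x) n \<and> 0 < n" and pq: "p \<le> q"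
  shows "polytime_rel (\<lambda>x y. accepts p q N (f x) y)"
proof -
  obtain c r where c: "\<And>x. runs_within c [x] (f x) (poly r (wsize x))"
    using f unfolding polytime_fun_def by blast
  obtain m0 where m0: "cfresh m0 c" using ex_cfresh by blast
  define m where "m = m0 + 2"
  have m: "2 \<le> m" "cfresh m c" using cfresh_mono[OF m0, of m] by (auto simp: m_def)
  define c0 where "c0 = p + q + N + 20"
  define cs where "cs = csize (stash_prog m) + csize (decision_prog p q N m)"
  \<comment> \<open>\<open>[:0, 1:]\<close> adds the input size to \<open>r\<close>, because the
    size of \<open>y\<close> also bounds values and rounds and need not be below \<open>r\<close>.
    The final 2 covers the output, one digit and a delimiter.\<close>
  define P where "P = r + [:cs:] * ((3 * (r + [:0, 1:]) + 5) * (5 * (r + [:0, 1:]) + [:c0 + 2:])) + [:2:]"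
  have "runs_within (Seq (stash_prog m) (Seq c (decision_prog p q N m))) [x, y]
    (if accepts p q N (f x) y then [1] else [0]) (poly P (wsize x + wsize y))" for x y
  proof -
    define z where "z = f x"
    define l where "l = poly r (wsize x + wsize y) + (wsize x + wsize y)"
    define K :: nat where "K = 2 ^ (c0 + 5 * l)"
    define M where "M = 3 * l + 5"
    obtain n where n: "graph_word z n" "0 < n" using gw[of x] by (auto simp: z_def)
    have mono: "poly r (wsize x) \<le> poly r (wsize x + wsize y)" by (rule poly_nat_mono) simp
    obtain t s where t: "exec c (load [x]) t s" "holds_word s z" "t + wsize z \<le> poly r (wsize x)"
      using runs_withinE[OF c[of x]] unfolding z_def by blast
    have zl: "wsize z \<le> l" using t(3) mono by (simp add: l_def)
    interpret bounded_word z n p q K M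
      unfolding K_def M_def c0_def by (intro bounded_word_standard(1) n pq zl)
    have K4: "2 * (2 ^ wsize z * 2 ^ wsize z * (N + 2) * (2 ^ wsize z * 2 ^ wsize z)) \<le> K"
      unfolding K_def c0_def by (intro bounded_word_standard(2)[OF n pq zl])
    have yl: "wsize y \<le> l" by (simp add: l_def)
    have yK: "entry y v \<le> K" for v
    proof (cases "v < length y")
      case True
      then have "y ! v \<le> 2 ^ wsize y" using nth_less_wsize[of v y] by linarith
      also have "\<dots> \<le> K" unfolding K_def using yl by (intro power_increasing) auto
      finally show ?thesis using True by (simp add: entry_def)
    qed (simp add: entry_def)
    have "length y + 1 \<le> c0 + 5 * l" using length_le_wsize[of y] yl by (simp add: c0_def)
    also have "\<dots> \<le> K" unfolding K_def by (intro less_imp_le less_exp)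
    finally have yK1: "length y + 1 \<le> K" .
    have yM: "length y < M" using length_le_wsize[of y] yl by (simp add: M_def)
    obtain t1 s1 where t1: "exec (stash_prog m) (load [x, y]) t1 s1"
      "t1 \<le> csize (stash_prog m) * (M * (1 + bits K))"
      "\<forall>a<m. s1 a = load [x] a" "\<forall>v. s1 m (Suc v) = entry y v"
      using reaches_stash[OF m(1) yK1 yK yM, of x] unfolding reaches_def by blast
    obtain s2 where s2: "exec c s1 t s2" "\<forall>a<m. s2 a = s a" "\<forall>a\<ge>m. s2 a = s1 a"
      using exec_agree[OF t(1) m(2) t1(3)] by blast
    have "holds_word s2 z" using t(2) s2(2) m(1) by (simp add: holds_word_def)
    moreover have "s2 m (Suc v) = entry y v" for v using s2(3) t1(4) by simp
    ultimately have "reaches K M (decision_prog p q N m) s2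
      (\<lambda>s'. holds_word s' (if accepts p q N z y then [1] else [0]))"
      using yK K4 by (intro reaches_decision m(1))
    then obtain t3 s3 where t3: "exec (decision_prog p q N m) s2 t3 s3"
      "t3 \<le> csize (decision_prog p q N m) * (M * (1 + bits K))"
      "holds_word s3 (if accepts p q N z y then [1] else [0])"
      unfolding reaches_def by blast
    have bK: "1 + bits K = 5 * l + (c0 + 2)" by (simp add: K_def bits_power)
    have "poly P (wsize x + wsize y) = poly r (wsize x + wsize y) + cs * (M * (1 + bits K)) + 2"
      unfolding P_def bK by (simp add: l_def M_def mult.commute)
    moreover have "cs * (M * (1 + bits K)) =
      csize (stash_prog m) * (M * (1 + bits K)) + csize (decision_prog p q N m) * (M * (1 + bits K))"
      unfolding cs_def by (rule add_mult_distrib)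
    moreover have "wsize (if accepts p q N z y then [1] else [0]) \<le> 2"
      by (simp add: wsize_def floorlog_def)
    ultimately have "t1 + (t + t3) + wsize (if accepts p q N z y then [1] else [0]) \<le> poly P (wsize x + wsize y)"
      using t(3) mono t1(2) t3(2) by linarith
    then show ?thesis
      using runs_withinI[OF exec_Seq[OF t1(1) exec_Seq[OF s2(1) t3(1)]]] t3(3) by (simp add: z_def)
  qed
  then show ?thesis unfolding polytime_rel_def by blast
qed

section \<open>Rationality of \<open>\<delta>\<close> and conclusion\<close>

lemma UNIV_in_NP: "UNIV \<in> NP"
proof -
  define c where "c = Seq (Store 0 (Num 1) (Num 1)) (Store 0 (Num 0) (Num 1))"
  define b where "b = csize c * (1 * (1 + bits 1)) + wsize [1]"
  have "runs_within c [x, y] [1] (poly [:b:] (wsize x + wsize y))" for x y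
  proof -
    have "reaches 1 1 c (load [x, y]) (\<lambda>s. holds_word s [1])"
      by (rule reaches_step) (auto simp: c_def holds_word_def)
    then obtain t s where "exec c (load [x, y]) t s" "t \<le> csize c * (1 * (1 + bits 1))" "holds_word s [1]"
      unfolding reaches_def by blast
    then show ?thesis by (intro runs_withinI) (auto simp: b_def)
  qed
  then have "polytime_rel (\<lambda>_ _. True)" unfolding polytime_rel_def by (intro exI[of _ c] exI[of _ "[:b:]"]) simp
  then show ?thesis unfolding NP_def
    by (intro CollectI exI[of _ "\<lambda>_ _. True"] exI[of _ 0]) (auto intro: exI[of _ "[]"] simp: wsize_def)
qed

text \<open>Reducing the language of all words produces a yes-instance. In it some set has exactly
  \<open>\<delta>\<close> times the size of a nonempty vertex set, so \<open>\<delta>\<close> is a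
  quotient of two cardinalities.\<close>

lemma sse_hard_rational:
  assumes "np_hard_promise (sse_yes \<eta> \<delta>) (sse_no \<eta> \<delta>)" "0 < \<delta>"
  obtains p q :: nat where "0 < p" "p \<le> q" "\<delta> = real p / real q"
proof -
  from bspec[OF assms(1)[unfolded np_hard_promise_def] UNIV_in_NP]
  obtain f where f: "polytime_fun f \<and>
    (\<forall>x. (x \<in> UNIV \<longrightarrow> f x \<in> sse_yes \<eta> \<delta>) \<and> (x \<notin> UNIV \<longrightarrow> f x \<in> sse_no \<eta> \<delta>))"
    by (rule exE)
  then have "f [] \<in> sse_yes \<eta> \<delta>" by simp
  then obtain G d S where G: "sse_instance (f []) G d" "S \<subseteq> verts G"
    "real (card S) = \<delta> * real (card (verts G))" unfolding sse_yes_def by blast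
  have V: "finite (verts G)" "verts G \<noteq> {}" using G(1) by (auto simp: sse_instance_def wgraph_def)
  then have c: "0 < card (verts G)" by (simp add: card_gt_0_iff)
  show thesis
  proof (rule that)
    have "0 < real (card S)" using G(3) c assms(2) by simp
    then show "0 < card S" by simp
    show "card S \<le> card (verts G)" using V G(2) by (simp add: card_mono)
    show "\<delta> = real (card S) / real (card (verts G))" using G(3) c by simp
  qed
qed

theorem theorem4:
  assumes small_set_expansion_hypothesis
  shows "\<forall>\<epsilon>::real. 0 < \<epsilon> \<and> \<epsilon> < 2 \<longrightarrow>
    np_hard_search fds_instances (fds_answer (2 - \<epsilon>))"
proof (intro allI impI)
  fix \<epsilon> :: real assume \<epsilon>: "0 < \<epsilon> \<and> \<epsilon> < 2"
  obtain N0 :: nat where N0: "5 / \<epsilon> < real N0" using reals_Archimedean2 by blast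
  \<comment> \<open>Taking \<open>\<eta>\<close> of the form \<open>1 / N\<close> lets the test
    clear it by an integer factor; adding 2 ensures \<open>\<eta> < 1\<close>.\<close>
  define N where "N = N0 + 2"
  have N: "1 < N" "5 / real N < \<epsilon>"
  proof -
    have "5 / \<epsilon> < real N" using N0 by (simp add: N_def)
    then show "5 / real N < \<epsilon>" using \<epsilon> by (simp add: N_def field_simps)
  qed (simp add: N_def)
  have "0 < 1 / real N \<and> 1 / real N < 1" using N(1) by simp
  then obtain \<delta> where \<delta>: "0 < \<delta>" "\<delta> < 1"
    and hard: "np_hard_promise (sse_yes (1 / real N) \<delta>) (sse_no (1 / real N) \<delta>)"
    using assms unfolding small_set_expansion_hypothesis_def by blast
  obtain p q :: nat where pq: "0 < p" "p \<le> q" "\<delta> = real p / real q"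
    by (rule sse_hard_rational[OF hard \<delta>(1)])
  show "np_hard_search fds_instances (fds_answer (2 - \<epsilon>))"
    unfolding np_hard_search_def
  proof
    fix L assume "L \<in> NP"
    from bspec[OF hard[unfolded np_hard_promise_def] this]
    obtain f where fr: "polytime_fun f \<and>
      (\<forall>x. (x \<in> L \<longrightarrow> f x \<in> sse_yes (1 / real N) \<delta>) \<and> (x \<notin> L \<longrightarrow> f x \<in> sse_no (1 / real N) \<delta>))"
      by (rule exE)
    note f = conjunct1[OF fr] and red = conjunct2[OF fr]
    \<comment> \<open>Both sides of the promise include being an instance, so \<open>f x\<close>
      encodes a regular graph for every \<open>x\<close> and the programs need no validity
      check.\<close>
    have inst: "\<exists>G d. sse_instance (f x) G d" for x
      using spec[OF red, of x] unfolding sse_yes_def sse_no_def by (cases "x \<in> L") auto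
    have word: "\<exists>n d. sse_word (f x) n d p q" for x
    proof -
      obtain G d where "sse_instance (f x) G d" using inst by blast
      then show ?thesis using pq(2) by (rule sse_word_of_instance) blast
    qed
    have gw: "\<exists>n. graph_word (f x) n \<and> 0 < n" for x
      using word[of x] unfolding sse_word_def by blast
    have "fds_word p q (f x) \<in> fds_instances" for x
      using word[of x] sse_word.fds_word_instance by blast
    moreover have "accepts p q N (f x) y \<longleftrightarrow> x \<in> L" if "fds_answer (2 - \<epsilon>) (fds_word p q (f x)) y" for x y
    proof
      assume "accepts p q N (f x) y"
      then show "x \<in> L" using sse_no_rejects[of "f x" N p q y] spec[OF red, of x] N(1) pq by auto
    next
      assume "x \<in> L"
      then show "accepts p q N (f x) y"
        using sse_yes_accepts[OF _ N(1) pq(2,1) N(2) _ that] spec[OF red, of x] \<epsilon> pq(3) by simp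
    qed
    ultimately show "\<exists>f g. polytime_fun f \<and> polytime_rel g \<and>
      (\<forall>x. f x \<in> fds_instances \<and> (\<forall>y. fds_answer (2 - \<epsilon>) (f x) y \<longrightarrow> (g x y \<longleftrightarrow> x \<in> L)))"
      using polytime_fds_word[OF f gw pq(2)] polytime_accepts[OF f gw pq(2), of N]
      by (intro exI[of _ "\<lambda>x. fds_word p q (f x)"] exI[of _ "\<lambda>x y. accepts p q N (f x) y"]) blast
  qed
qed

end
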